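(* Let $f\in L^2(\Omega)$. Let $u_h^{\rm PEQ}\in V_h^{\rm EQ}$ be the solution of the projected $\mathrm{E}Q_1^{\rm rot}$ scheme $$(\nabla_hu_h^{\rm PEQ},\nabla_hv_h)=(\Pi_0f,v_h)\quad\forall v_h\in V_h^{\rm EQ},$$ and let $(\boldsymbol\sigma_h^{\rm RRT},u_h^{\rm RRT})\in\boldsymbol\Sigma_h\times V_h$ be the solution of the rectangular Raviart-Thomas scheme $$(\boldsymbol\sigma_h^{\rm RRT},\boldsymbol\tau_h)-(\operatorname{div}\boldsymbol\tau_h,u_h^{\rm RRT})=0\ \ \forall\boldsymbol\tau_h\in\boldsymbol\Sigma_h,\qquad(\operatorname{div}\boldsymbol\sigma_h^{\rm RRT},v_h)=(f,v_h)\ \ \forall v_h\in V_h.$$ Then $$\boldsymbol\sigma_h^{\rm RRT}=-\nabla_hu_h^{\rm PEQ},\qquad u_h^{\rm RRT}=\Pi_0u_h^{\rm PEQ}.$$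
   Context: $\Omega\subset\mathbb R^2$ is a connected bounded domain that can be divided into non-overlapping axis-parallel rectangles without hanging nodes, and $\mathcal T_h$ is a mesh of $\overline\Omega$ consisting of the cells $[x_{i-1},x_i]\times[y_{j-1},y_j]\subset\overline\Omega$ of a grid $x_0<\dots<x_{n_1}$, $y_0<\dots<y_{n_2}$. $\mathcal E_h$ is the set of all edges of $\mathcal T_h$. $\llbracket v\rrbracket_e$ is the jump of $v$ across $e$ (the trace of $v$ if $e\subset\partial\Omega$). $\nabla_h$ is the elementwise gradient; $(\cdot,\cdot)$ is the $L^2(\Omega)$ inner product. With $Q_{mn}=\operatorname{span}\{x^iy^j:0\le i\le m,0\le j\le n\}$: $\boldsymbol\Sigma_h=\{\boldsymbol\tau_h\in\boldsymbol H(\operatorname{div},\Omega):\boldsymbol\tau_h|_K\in Q_{10}(K)\times Q_{01}(K)\ \forall K\in\mathcal T_h\}$; $V_h=\{v_h\in L^2(\Omega):v_h|_K\text{ constant }\forall K\in\mathcal T_h\}$; $\Pi_0$ is the $L^2$-orthogonal projection onto $V_h$. The $\mathrm{E}Q_1^{\rm rot}$ space is $V_h^{\rm EQ}=\{v_h\in L^2(\Omega):v_h|_K\in\operatorname{span}\{1,x,y,x^2,y^2\}\ \forall K\in\mathcal T_h,\ \int_e\llbracket v_h\rrbracket_e\,de=0\ \forall e\in\mathcal E_h\}$. *)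

theory Defs
  imports "HOL-Analysis.Analysis"
begin

type_synonym point = "real \<times> real"

section \<open>Lebesgue and Sobolev spaces\<close>

text \<open>Elements of L2 are represented by functions on the whole plane of which only the values
  on the domain matter; equality of two elements is equality almost everywhere on the domain.\<close>

definition L2_space :: "point set \<Rightarrow> (point \<Rightarrow> 'b::euclidean_space) set" where
  "L2_space \<Omega> = {v. v \<in> borel_measurable (lebesgue_on \<Omega>) \<and>
                    integrable (lebesgue_on \<Omega>) (\<lambda>z. (norm (v z))\<^sup>2)}"

definition L2_inner :: "point set \<Rightarrow> (point \<Rightarrow> 'b::euclidean_space) \<Rightarrow> (point \<Rightarrow> 'b) \<Rightarrow> real" where
  "L2_inner \<Omega> v w = (\<integral>z. v z \<bullet> w z \<partial>lebesgue_on \<Omega>)"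

text \<open>The orthogonal projection of an element of L2 onto a subspace, determined up to
  equality almost everywhere.\<close>

definition L2_projection ::
  "point set \<Rightarrow> (point \<Rightarrow> real) set \<Rightarrow> (point \<Rightarrow> real) \<Rightarrow> point \<Rightarrow> real" where
  "L2_projection \<Omega> V g =
     (SOME w. w \<in> V \<and> (\<forall>v\<in>V. L2_inner \<Omega> (\<lambda>z. g z - w z) v = 0))"

definition grad :: "(point \<Rightarrow> real) \<Rightarrow> point \<Rightarrow> point" where
  "grad v z = (frechet_derivative v (at z) (1, 0), frechet_derivative v (at z) (0, 1))"

primrec C_k :: "nat \<Rightarrow> (point \<Rightarrow> real) \<Rightarrow> bool" where
  "C_k 0 v \<longleftrightarrow> continuous_on UNIV v"
| "C_k (Suc k) v \<longleftrightarrow> (\<forall>z. v differentiable (at z)) \<and>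
     C_k k (\<lambda>z. fst (grad v z)) \<and> C_k k (\<lambda>z. snd (grad v z))"

definition test_functions :: "point set \<Rightarrow> (point \<Rightarrow> real) set" where
  "test_functions \<Omega> = {\<phi>. (\<forall>k. C_k k \<phi>) \<and>
     compact (closure {z. \<phi> z \<noteq> 0}) \<and> closure {z. \<phi> z \<noteq> 0} \<subseteq> \<Omega>}"

definition has_weak_div :: "point set \<Rightarrow> (point \<Rightarrow> point) \<Rightarrow> (point \<Rightarrow> real) \<Rightarrow> bool" where
  "has_weak_div \<Omega> \<tau> d \<longleftrightarrow> d \<in> L2_space \<Omega> \<and>
     (\<forall>\<phi>\<in>test_functions \<Omega>. L2_inner \<Omega> \<tau> (grad \<phi>) = - L2_inner \<Omega> d \<phi>)"

definition H_div :: "point set \<Rightarrow> (point \<Rightarrow> point) set" where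
  "H_div \<Omega> = {\<tau>. \<tau> \<in> L2_space \<Omega> \<and> (\<exists>d. has_weak_div \<Omega> \<tau> d)}"

definition weak_div :: "point set \<Rightarrow> (point \<Rightarrow> point) \<Rightarrow> point \<Rightarrow> real" where
  "weak_div \<Omega> \<tau> = (SOME d. has_weak_div \<Omega> \<tau> d)"

section \<open>Meshes, edges and jumps\<close>

definition grid_mesh ::
  "point set \<Rightarrow> nat \<Rightarrow> (nat \<Rightarrow> real) \<Rightarrow> nat \<Rightarrow> (nat \<Rightarrow> real) \<Rightarrow> point set set" where
  "grid_mesh \<Omega> n\<^sub>1 x n\<^sub>2 y =
     {K. \<exists>i\<in>{1..n\<^sub>1}. \<exists>j\<in>{1..n\<^sub>2}.
           K = {x (i - 1)..x i} \<times> {y (j - 1)..y j} \<and> K \<subseteq> closure \<Omega>}"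

text \<open>An edge is given by its two end points, ordered from left to right or from bottom to top,
  so that the common edge of two cells is the same pair for both.\<close>

type_synonym edge = "point \<times> point"

definition cell_edges :: "point set \<Rightarrow> edge set" where
  "cell_edges K = {e. \<exists>a b c d. a < b \<and> c < d \<and> K = {a..b} \<times> {c..d} \<and>
     e \<in> {((a, c), (b, c)), ((a, d), (b, d)), ((a, c), (a, d)), ((b, c), (b, d))}}"

definition mesh_edges :: "point set set \<Rightarrow> edge set" where
  "mesh_edges T = (\<Union>K\<in>T. cell_edges K)"

definition edge_integral :: "edge \<Rightarrow> (point \<Rightarrow> real) \<Rightarrow> real" where
  "edge_integral e g =
     dist (fst e) (snd e) * integral {0..1} (\<lambda>t. g (linepath (fst e) (snd e) t))"

definition cell_trace :: "point set \<Rightarrow> (point \<Rightarrow> real) \<Rightarrow> point \<Rightarrow> real" where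
  "cell_trace K v z = Lim (at z within interior K) v"

text \<open>The possible jumps of a function across an edge. Across an edge not contained in the
  boundary there are two of them, one for each choice of the normal direction. On an edge
  contained in the boundary the jump is the trace; there is one trace unless the domain lies on
  both sides of the edge (a slit), in which case both one-sided traces are taken.\<close>

definition jumps ::
  "point set \<Rightarrow> point set set \<Rightarrow> (point \<Rightarrow> real) \<Rightarrow> edge \<Rightarrow> (point \<Rightarrow> real) set" where
  "jumps \<Omega> T v e =
     (if closed_segment (fst e) (snd e) \<subseteq> frontier \<Omega>
      then {cell_trace K v | K. K \<in> T \<and> e \<in> cell_edges K}
      else {\<lambda>z. cell_trace K v z - cell_trace K' v z | K K'.
              K \<in> T \<and> K' \<in> T \<and> K \<noteq> K' \<and> e \<in> cell_edges K \<and> e \<in> cell_edges K'})"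

section \<open>Discrete spaces\<close>

text \<open>Functions with a polynomial restriction to each cell are represented by functions that agree
  with that polynomial at all points of the open cell; the values on the cell boundaries, which
  form a null set, are left arbitrary. Hence the traces and the elementwise gradient can be
  computed from the values in the open cells.\<close>

definition Q_poly :: "nat \<Rightarrow> nat \<Rightarrow> (point \<Rightarrow> real) set" where
  "Q_poly m n = {p. \<exists>c. \<forall>s t. p (s, t) = (\<Sum>i\<le>m. \<Sum>j\<le>n. c i j * s ^ i * t ^ j)}"

definition EQ_poly :: "(point \<Rightarrow> real) set" where
  "EQ_poly = {p. \<exists>c\<^sub>0 c\<^sub>1 c\<^sub>2 c\<^sub>3 c\<^sub>4. \<forall>s t.
     p (s, t) = c\<^sub>0 + c\<^sub>1 * s + c\<^sub>2 * t + c\<^sub>3 * s\<^sup>2 + c\<^sub>4 * t\<^sup>2}"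

definition RT_space :: "point set \<Rightarrow> point set set \<Rightarrow> (point \<Rightarrow> point) set" where
  "RT_space \<Omega> T = {\<tau>. \<tau> \<in> H_div \<Omega> \<and>
     (\<forall>K\<in>T. \<exists>p\<in>Q_poly 1 0. \<exists>q\<in>Q_poly 0 1. \<forall>z\<in>interior K. \<tau> z = (p z, q z))}"

definition P0_space :: "point set \<Rightarrow> point set set \<Rightarrow> (point \<Rightarrow> real) set" where
  "P0_space \<Omega> T = {v. v \<in> L2_space \<Omega> \<and> (\<forall>K\<in>T. \<exists>c. \<forall>z\<in>interior K. v z = c)}"

definition EQ_space :: "point set \<Rightarrow> point set set \<Rightarrow> (point \<Rightarrow> real) set" where
  "EQ_space \<Omega> T = {v. v \<in> L2_space \<Omega> \<and>
     (\<forall>K\<in>T. \<exists>p\<in>EQ_poly. \<forall>z\<in>interior K. v z = p z) \<and>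
     (\<forall>e\<in>mesh_edges T. \<forall>g\<in>jumps \<Omega> T v e. edge_integral e g = 0)}"

definition broken_grad :: "point set set \<Rightarrow> (point \<Rightarrow> real) \<Rightarrow> point \<Rightarrow> point" where
  "broken_grad T v z = (if z \<in> (\<Union>K\<in>T. interior K) then grad v z else 0)"

definition proj0 :: "point set \<Rightarrow> point set set \<Rightarrow> (point \<Rightarrow> real) \<Rightarrow> point \<Rightarrow> real" where
  "proj0 \<Omega> T = L2_projection \<Omega> (P0_space \<Omega> T)"

definition PEQ_solution ::
  "point set \<Rightarrow> point set set \<Rightarrow> (point \<Rightarrow> real) \<Rightarrow> (point \<Rightarrow> real) \<Rightarrow> bool" where
  "PEQ_solution \<Omega> T f u \<longleftrightarrow> u \<in> EQ_space \<Omega> T \<and>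
     (\<forall>v\<in>EQ_space \<Omega> T.
        L2_inner \<Omega> (broken_grad T u) (broken_grad T v) = L2_inner \<Omega> (proj0 \<Omega> T f) v)"

definition RRT_solution ::
  "point set \<Rightarrow> point set set \<Rightarrow> (point \<Rightarrow> real) \<Rightarrow> (point \<Rightarrow> point) \<Rightarrow> (point \<Rightarrow> real) \<Rightarrow> bool" where
  "RRT_solution \<Omega> T f \<sigma> u \<longleftrightarrow> \<sigma> \<in> RT_space \<Omega> T \<and> u \<in> P0_space \<Omega> T \<and>
     (\<forall>\<tau>\<in>RT_space \<Omega> T. L2_inner \<Omega> \<sigma> \<tau> - L2_inner \<Omega> (weak_div \<Omega> \<tau>) u = 0) \<and>
     (\<forall>v\<in>P0_space \<Omega> T. L2_inner \<Omega> (weak_div \<Omega> \<sigma>) v = L2_inner \<Omega> f v)"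

end

(* On each cell sigma_RRT is minus the gradient of a polynomial of the EQ type, unique up to a constant;
   choose the constant so that its mean is u_RRT, and call the resulting piecewise function w.
   Testing the first RT equation with the RT field that has unit flux through a single edge and
   integrating by parts shows that the jumps of w have mean zero, so w lies in the EQ space.
   Conversely sigma_RRT, being in H(div), has continuous normal components (tested with smooth bumps
   concentrating at an edge) and its weak divergence has the right cell means (tested with bumps
   approximating the indicator of a cell). Integrating by parts against an EQ function therefore
   shows that w solves the projected EQ scheme. Two solutions have the same broken gradient, and
   since the difference is constant on cells with vanishing jumps, it vanishes: walk along a row of
   cells until the boundary is reached. *)

theory Submission
  imports Defs "HOL-Computational_Algebra.Polynomial"
begin

text \<open>The domain contains the open cells but may be slit along an edge or along a piece of
  one. An edge is therefore either contained in the frontier, where test functions vanish and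
  nothing ties the two sides together, or it has a point in the domain. In the second case a
  neighbourhood of that one point decides the whole edge, since the normal component of a
  Raviart-Thomas field is constant on each edge. \<open>weak_div\<close> is a choice among weak
  divergences, about whose values nothing is proved; it is only paired with piecewise constants, and
  for these its cell means suffice. The bumps enter through one identity: paired with a test
  function, the weak minus the elementwise divergence gives minus the boundary sum of Green's
  formula. Bumps inside a cell have no boundary sum; bumps shrinking onto an edge make the pairing
  tend to 0 while the boundary sum stays fixed. The projection of f makes the right-hand side
  constant on cells, as the divergence of a Raviart-Thomas field is, and this is why the two schemes
  meet exactly in w.\<close>

section \<open>Smooth bump functions\<close>

text \<open>With X = 1/t, differentiating P(X) exp(-X) in t gives X^2 (P(X) - P'(X)) exp(-X),
  because dX/dt = -X^2; the factor \<open>[:0, 0, 1:]\<close> is X^2.\<close>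

fun expinv_poly :: "nat \<Rightarrow> real poly" where
  "expinv_poly 0 = 1"
| "expinv_poly (Suc n) = [:0, 0, 1:] * (expinv_poly n - pderiv (expinv_poly n))"

text \<open>The n-th derivative of exp(-1/t), extended by zero to t \<le> 0. Indexing the family by
  the order of the derivative makes smoothness a plain induction.\<close>

definition expinv :: "nat \<Rightarrow> real \<Rightarrow> real" where
  "expinv n t = (if t > 0 then poly (expinv_poly n) (1 / t) * exp (- (1 / t)) else 0)"

text \<open>The extra power \<open>X ^ k\<close> is what carries the induction: splitting
  \<open>pCons a p\<close> into a + X p moves one factor X from the polynomial to the power.\<close>

lemma poly_exp_tendsto_0: "((\<lambda>X::real. X ^ k * poly p X * exp (- X)) \<longlongrightarrow> 0) at_top"
proof (induction p arbitrary: k)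
  case 0
  then show ?case by simp
next
  case (pCons a p)
  have "((\<lambda>X::real. a * (X ^ k / exp X) + X ^ Suc k * poly p X * exp (- X)) \<longlongrightarrow> a * 0 + 0) at_top"
    by (intro tendsto_intros tendsto_power_div_exp_0 pCons.IH)
  moreover have "(\<lambda>X::real. a * (X ^ k / exp X) + X ^ Suc k * poly p X * exp (- X)) =
      (\<lambda>X. X ^ k * poly (pCons a p) X * exp (- X))"
    by (auto simp: fun_eq_iff exp_minus field_simps)
  ultimately show ?case by simp
qed

lemma expinv_has_derivative: "(expinv n has_real_derivative expinv (Suc n) t) (at t)"
proof -
  consider "t > 0" | "t < 0" | "t = 0" by linarith
  then show ?thesis
  proof cases
    case 1
    have "((\<lambda>t. poly (expinv_poly n) (1 / t) * exp (- (1 / t))) has_real_derivative expinv (Suc n) t) (at t)"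
      using 1 unfolding expinv_def
      by (auto intro!: derivative_eq_intros DERIV_chain2[OF poly_DERIV] simp: field_simps power2_eq_square)
    moreover have "eventually (\<lambda>t. poly (expinv_poly n) (1 / t) * exp (- (1 / t)) = expinv n t) (nhds t)"
      using eventually_nhds_in_open[of "{0<..}" t] 1
      by (auto simp: expinv_def elim!: eventually_mono)
    ultimately show ?thesis
      by (rule DERIV_cong_ev[THEN iffD1, rotated 3, OF _ refl _ refl])
  next
    case 2
    have "((\<lambda>t. 0) has_real_derivative expinv (Suc n) t) (at t)"
      using 2 by (simp add: expinv_def)
    moreover have "eventually (\<lambda>t. 0 = expinv n t) (nhds t)"
      using eventually_nhds_in_open[of "{..<0}" t] 2
      by (auto simp: expinv_def elim!: eventually_mono)
    ultimately show ?thesis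
      by (rule DERIV_cong_ev[THEN iffD1, rotated 3, OF _ refl _ refl])
  next
    case 3
    \<comment> \<open>The difference quotient at 0 from the right is X P(X) exp(-X) with X = 1/h,
      hence the exponent 1.\<close>
    have "((\<lambda>X::real. X ^ 1 * poly (expinv_poly n) X * exp (- X)) \<longlongrightarrow> 0) at_top"
      by (rule poly_exp_tendsto_0)
    then have "((\<lambda>h. (1 / h) ^ 1 * poly (expinv_poly n) (1 / h) * exp (- (1 / h))) \<longlongrightarrow> 0) (at_right (0::real))"
      using filterlim_inverse_at_top_right by (rule filterlim_compose[where g="\<lambda>X. X ^ 1 * poly (expinv_poly n) X * exp (- X)", THEN filterlim_cong[THEN iffD1, rotated 3]])
         (auto simp: field_simps)
    then have r: "((\<lambda>h. expinv n h / h) \<longlongrightarrow> 0) (at_right (0::real))"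
      by (rule filterlim_cong[THEN iffD1, rotated 3, OF _ refl refl])
         (auto simp: expinv_def eventually_at_filter)
    have l: "((\<lambda>h. expinv n h / h) \<longlongrightarrow> 0) (at_left (0::real))"
      by (rule tendsto_eventually) (auto simp: expinv_def eventually_at_filter)
    from l r have "((\<lambda>h. expinv n h / h) \<longlongrightarrow> 0) (at (0::real))"
      by (rule filterlim_split_at_real)
    then show ?thesis using 3 by (simp add: DERIV_def expinv_def)
  qed
qed

section \<open>Calculus of the classes \<open>C_k\<close>\<close>

lemma C_kD:
  assumes "C_k (Suc k) v"
  shows "(v has_derivative (\<lambda>h. fst (grad v z) * fst h + snd (grad v z) * snd h)) (at z)"
proof -
  have d: "(v has_derivative frechet_derivative v (at z)) (at z)"
    using assms unfolding C_k.simps frechet_derivative_works by blast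
  then interpret bounded_linear "frechet_derivative v (at z)" by (rule has_derivative_bounded_linear)
  have "frechet_derivative v (at z) h = fst (grad v z) * fst h + snd (grad v z) * snd h" for h
  proof -
    have "h = fst h *\<^sub>R (1, 0) + snd h *\<^sub>R (0, 1)" by (simp add: prod_eq_iff)
    then have "frechet_derivative v (at z) h =
        fst h *\<^sub>R frechet_derivative v (at z) (1, 0) + snd h *\<^sub>R frechet_derivative v (at z) (0, 1)"
      by (metis add scaleR)
    then show ?thesis by (simp add: grad_def)
  qed
  then have "frechet_derivative v (at z) = (\<lambda>h. fst (grad v z) * fst h + snd (grad v z) * snd h)" by blast
  with d show ?thesis by simp
qed

lemma grad_eqI:
  assumes "(v has_derivative (\<lambda>h. A * fst h + B * snd h)) (at z)"
  shows "grad v z = (A, B)"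
  using frechet_derivative_at[OF assms, symmetric] by (simp add: grad_def)

text \<open>Together with \<open>C_kD\<close> this hides \<open>frechet_derivative\<close>:
  derivatives are found by the usual rules and only then read off as partial derivatives.\<close>

lemma C_k_SucI:
  assumes d: "\<And>z. (v has_derivative (\<lambda>h. A z * fst h + B z * snd h)) (at z)"
    and "C_k k A" "C_k k B"
  shows "C_k (Suc k) v"
proof -
  have "grad v = (\<lambda>z. (A z, B z))" using grad_eqI[OF d] by (simp add: fun_eq_iff)
  moreover have "\<forall>z. v differentiable (at z)" using d unfolding differentiable_def by blast
  ultimately show ?thesis using assms(2,3) unfolding C_k.simps by simp
qed

text \<open>\<open>C_k (Suc k) v\<close> speaks of the differentiability of v and of the class of
  its partials; the lower class of v itself has to be recovered, since the product rule also
  contains the undifferentiated factors.\<close>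

lemma C_k_Suc_imp: "C_k (Suc k) v \<Longrightarrow> C_k k v"
proof (induction k arbitrary: v)
  case 0
  then have "\<forall>z. v differentiable (at z)" unfolding C_k.simps by blast
  then show ?case
    by (simp add: continuous_at_imp_continuous_on differentiable_imp_continuous_within)
next
  case (Suc k)
  from Suc.prems have "C_k (Suc k) (\<lambda>z. fst (grad v z))" "C_k (Suc k) (\<lambda>z. snd (grad v z))"
    "\<forall>z. v differentiable (at z)" unfolding C_k.simps(2)[of "Suc k"] by blast+
  then show ?case using Suc.IH unfolding C_k.simps(2)[of k] by blast
qed

lemma C_k_continuous: "C_k k v \<Longrightarrow> continuous_on UNIV v"
proof (induction k)
  case 0
  then show ?case by simp
next
  case (Suc k)
  then show ?case using C_k_Suc_imp by blast
qed

lemma C_k_const: "C_k k (\<lambda>z. c)"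
proof (induction k arbitrary: c)
  case 0
  then show ?case by simp
next
  case (Suc k)
  show ?case
    by (rule C_k_SucI[where A="\<lambda>z. 0" and B="\<lambda>z. 0"]) (simp_all add: Suc del: C_k.simps)
qed

lemma C_k_add: "C_k k u \<Longrightarrow> C_k k v \<Longrightarrow> C_k k (\<lambda>z. u z + v z)"
proof (induction k arbitrary: u v)
  case 0
  then show ?case by (auto intro: continuous_intros)
next
  case (Suc k)
  show ?case
  proof (rule C_k_SucI)
    show "((\<lambda>z. u z + v z) has_derivative
        (\<lambda>h. (fst (grad u z) + fst (grad v z)) * fst h + (snd (grad u z) + snd (grad v z)) * snd h)) (at z)" for z
      using has_derivative_add[OF C_kD[OF Suc.prems(1)] C_kD[OF Suc.prems(2)], of z]
      by (simp add: algebra_simps)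
  next
    show "C_k k (\<lambda>z. fst (grad u z) + fst (grad v z))" "C_k k (\<lambda>z. snd (grad u z) + snd (grad v z))"
      using Suc.prems unfolding C_k.simps by (simp_all only: Suc.IH)
  qed
qed

lemma C_k_mult: "C_k k u \<Longrightarrow> C_k k v \<Longrightarrow> C_k k (\<lambda>z. u z * v z)"
proof (induction k arbitrary: u v)
  case 0
  then show ?case by (auto intro: continuous_intros)
next
  case (Suc k)
  have uv: "C_k k u" "C_k k v" "C_k k (\<lambda>z. fst (grad u z))" "C_k k (\<lambda>z. fst (grad v z))"
    "C_k k (\<lambda>z. snd (grad u z))" "C_k k (\<lambda>z. snd (grad v z))"
    using Suc.prems C_k_Suc_imp[OF Suc.prems(1)] C_k_Suc_imp[OF Suc.prems(2)]
    unfolding C_k.simps by blast+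
  show ?case
  proof (rule C_k_SucI)
    show "((\<lambda>z. u z * v z) has_derivative
        (\<lambda>h. (u z * fst (grad v z) + fst (grad u z) * v z) * fst h +
             (u z * snd (grad v z) + snd (grad u z) * v z) * snd h)) (at z)" for z
      using has_derivative_mult[OF C_kD[OF Suc.prems(1)] C_kD[OF Suc.prems(2)], of z]
      by (simp add: algebra_simps)
  qed (intro C_k_add Suc.IH uv)+
qed

text \<open>Both partials are multiples of the next member of the family, so the induction runs for
  all n at once. Taking q or r to be 0 gives the one-variable factors of
  \<open>bump\<close>.\<close>

lemma C_k_expinv: "C_k k (\<lambda>z. expinv n (p + q * fst z + r * snd z))"
proof (induction k arbitrary: n)
  case 0
  have "continuous_on UNIV (expinv n)"
    by (meson DERIV_isCont continuous_at_imp_continuous_on expinv_has_derivative)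
  then have "continuous_on UNIV (\<lambda>z. expinv n (p + q * fst z + r * snd z))"
    by (rule continuous_on_compose2) (auto intro!: continuous_intros)
  then show ?case by simp
next
  case (Suc k)
  show ?case
  proof (rule C_k_SucI[where A="\<lambda>z. q * expinv (Suc n) (p + q * fst z + r * snd z)"
         and B="\<lambda>z. r * expinv (Suc n) (p + q * fst z + r * snd z)"])
    fix z :: point
    have "((\<lambda>z. p + q * fst z + r * snd z) has_derivative (\<lambda>h. q * fst h + r * snd h)) (at z)"
      by (auto intro!: derivative_eq_intros)
    from has_derivative_compose[OF this expinv_has_derivative[of n, unfolded has_field_derivative_def]]
    show "((\<lambda>z. expinv n (p + q * fst z + r * snd z)) has_derivative
       (\<lambda>h. q * expinv (Suc n) (p + q * fst z + r * snd z) * fst h + r * expinv (Suc n) (p + q * fst z + r * snd z) * snd h)) (at z)"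
      by (simp add: algebra_simps)
  qed (use Suc in \<open>auto intro!: C_k_mult C_k_const simp del: C_k.simps\<close>)
qed

lemma expinv_0_bounds: "0 \<le> expinv 0 t" "expinv 0 t \<le> 1"
  by (auto simp: expinv_def)

lemma expinv_0_pos_iff: "0 < expinv 0 t \<longleftrightarrow> 0 < t"
  by (auto simp: expinv_def)

text \<open>A flank of slope n + 1 whose foot is moved inwards by 1 / (n + 1) has, at a fixed point,
  an argument of this affine form.\<close>

lemma expinv_0_tendsto_1:
  assumes "q > 0"
  shows "(\<lambda>n. expinv 0 (p + q * real n)) \<longlonglongrightarrow> 1"
proof -
  have lim: "filterlim (\<lambda>n. p + q * real n) at_top sequentially"
    using assms
    by (intro filterlim_tendsto_add_at_top[OF tendsto_const]
        filterlim_tendsto_pos_mult_at_top[OF tendsto_const] filterlim_real_sequentially)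
  have "((\<lambda>t::real. exp (- inverse t)) \<longlongrightarrow> exp (- 0)) at_top"
    by (intro tendsto_intros tendsto_inverse_0_at_top filterlim_ident)
  then have "((\<lambda>t::real. exp (- (1 / t))) \<longlongrightarrow> 1) at_top"
    by (simp add: inverse_eq_divide)
  then have "((\<lambda>t. expinv 0 t) \<longlongrightarrow> 1) at_top"
    by (rule filterlim_cong[THEN iffD1, rotated 3, OF _ refl refl])
       (auto intro!: eventually_at_top_linorderI[of 1] simp: expinv_def)
  from filterlim_compose[OF this lim] show ?thesis .
qed

text \<open>A smooth function whose support is \<open>[a, b] \<times> [c, d]\<close>; the larger \<open>q\<close> and \<open>r\<close>, the steeper
  its flanks.\<close>

definition bump :: "real \<Rightarrow> real \<Rightarrow> real \<Rightarrow> real \<Rightarrow> real \<Rightarrow> real \<Rightarrow> point \<Rightarrow> real" where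
  "bump q a b r c d z = expinv 0 (q * (fst z - a)) * expinv 0 (q * (b - fst z)) *
     (expinv 0 (r * (snd z - c)) * expinv 0 (r * (d - snd z)))"

lemma bump_C_k: "C_k k (bump q a b r c d)"
proof -
  have "bump q a b r c d =
    (\<lambda>z. expinv 0 (- q * a + q * fst z + 0 * snd z) * expinv 0 (q * b + (- q) * fst z + 0 * snd z) *
     (expinv 0 (- r * c + 0 * fst z + r * snd z) * expinv 0 (r * d + 0 * fst z + (- r) * snd z)))"
    by (rule ext) (simp add: bump_def algebra_simps)
  then show ?thesis by (simp only: C_k_mult C_k_expinv)
qed

lemma bump_bounds: "0 \<le> bump q a b r c d z" "bump q a b r c d z \<le> 1"
  unfolding bump_def by (intro mult_nonneg_nonneg mult_le_one expinv_0_bounds)+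

lemma bump_eq_0:
  assumes "q > 0" "r > 0" "\<not> (a < fst z \<and> fst z < b \<and> c < snd z \<and> snd z < d)"
  shows "bump q a b r c d z = 0"
  using assms by (auto simp: bump_def expinv_def zero_less_mult_iff)

lemma bump_pos:
  assumes "q > 0" "r > 0" "a < fst z" "fst z < b" "c < snd z" "snd z < d"
  shows "bump q a b r c d z > 0"
  unfolding bump_def by (intro mult_pos_pos) (use assms in \<open>simp_all add: expinv_0_pos_iff\<close>)

lemma bump_test_function:
  assumes "q > 0" "r > 0" "cbox (a, c) (b, d) \<subseteq> \<Omega>"
  shows "bump q a b r c d \<in> test_functions \<Omega>"
proof -
  have "{z. bump q a b r c d z \<noteq> 0} \<subseteq> cbox (a, c) (b, d)"
  proof
    fix z assume "z \<in> {z. bump q a b r c d z \<noteq> 0}"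
    then have "a < fst z \<and> fst z < b \<and> c < snd z \<and> snd z < d"
      using bump_eq_0[OF assms(1,2)] by blast
    then show "z \<in> cbox (a, c) (b, d)" by (cases z) (simp add: cbox_Pair_eq)
  qed
  then have s: "closure {z. bump q a b r c d z \<noteq> 0} \<subseteq> cbox (a, c) (b, d)"
    by (intro closure_minimal closed_cbox)
  then have "compact (closure {z. bump q a b r c d z \<noteq> 0})"
    by (meson bounded_cbox bounded_subset closed_closure compact_eq_bounded_closed)
  with s assms(3) bump_C_k show ?thesis unfolding test_functions_def by blast
qed

section \<open>Green's formula on a rectangle and inner products\<close>

text \<open>The affine interpolant of the values l at a and r at b. Using end values as parameters
  makes the degrees of freedom of a Raviart-Thomas field, its normal components on the four edges,
  visible.\<close>

definition ramp :: "real \<Rightarrow> real \<Rightarrow> real \<Rightarrow> real \<Rightarrow> real \<Rightarrow> real" where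
  "ramp a b l r s = l + (r - l) / (b - a) * (s - a)"

lemma ramp_simps: "ramp a b l r a = l" "a \<noteq> b \<Longrightarrow> ramp a b l r b = r"
  by (auto simp: ramp_def)

lemma continuous_on_ramp [continuous_intros]:
  "continuous_on S f \<Longrightarrow> continuous_on S (\<lambda>z. ramp a b l r (f z))"
  unfolding ramp_def by (intro continuous_intros)

lemma C_k_Suc_continuous:
  assumes "C_k (Suc k) v"
  shows "continuous_on S v" "continuous_on S (\<lambda>z. fst (grad v z))" "continuous_on S (\<lambda>z. snd (grad v z))"
    "continuous_on S (grad v)"
proof -
  have "continuous_on UNIV v" by (rule C_k_continuous[OF assms])
  moreover have *: "continuous_on UNIV (\<lambda>z. fst (grad v z))" "continuous_on UNIV (\<lambda>z. snd (grad v z))"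
    using assms C_k_continuous unfolding C_k.simps by blast+
  moreover have "continuous_on UNIV (grad v)"
    using continuous_on_Pair[OF *] by simp
  ultimately show "continuous_on S v" "continuous_on S (\<lambda>z. fst (grad v z))" "continuous_on S (\<lambda>z. snd (grad v z))"
    "continuous_on S (grad v)"
    by (auto intro: continuous_on_subset)
qed

lemma C_k_partial_derivatives:
  assumes "C_k (Suc k) v"
  shows "((\<lambda>s. v (s, t)) has_real_derivative fst (grad v (s, t))) (at s within S)"
    and "((\<lambda>t. v (s, t)) has_real_derivative snd (grad v (s, t))) (at t within S')"
proof -
  have "((\<lambda>s. (s, t)) has_derivative (\<lambda>h. (h, 0))) (at s)"
    by (auto intro!: derivative_eq_intros)
  from has_derivative_compose[OF this C_kD[OF assms]]
  have "((\<lambda>s. v (s, t)) has_real_derivative fst (grad v (s, t))) (at s)"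
    by (simp add: has_field_derivative_def)
  then show "((\<lambda>s. v (s, t)) has_real_derivative fst (grad v (s, t))) (at s within S)"
    by (rule has_field_derivative_at_within)
  have "((\<lambda>t. (s, t)) has_derivative (\<lambda>h. (0, h))) (at t)"
    by (auto intro!: derivative_eq_intros)
  from has_derivative_compose[OF this C_kD[OF assms]]
  have "((\<lambda>t. v (s, t)) has_real_derivative snd (grad v (s, t))) (at t)"
    by (simp add: has_field_derivative_def)
  then show "((\<lambda>t. v (s, t)) has_real_derivative snd (grad v (s, t))) (at t within S')"
    by (rule has_field_derivative_at_within)
qed

text \<open>The integrand is the derivative of the product of the ramp and p, the slope of the ramp
  being (r - l) / (b - a).\<close>

lemma integral_ramp_mult:
  fixes p :: "real \<Rightarrow> real"
  assumes ab: "a < b" and p: "\<And>s. (p has_real_derivative p' s) (at s within {a..b})"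
  shows "integral {a..b} (\<lambda>s. ramp a b l r s * p' s + (r - l) / (b - a) * p s) = r * p b - l * p a"
proof -
  have "((\<lambda>s. ramp a b l r s * p s) has_vector_derivative
      (ramp a b l r s * p' s + (r - l) / (b - a) * p s)) (at s within {a..b})" for s
  proof -
    have "((\<lambda>s. (l + m * (s - a)) * p s) has_real_derivative (l + m * (s - a)) * p' s + m * p s)
        (at s within {a..b})" for m
      by (auto intro!: derivative_eq_intros p)
    then show ?thesis
      unfolding ramp_def has_real_derivative_iff_has_vector_derivative[symmetric] .
  qed
  then have "((\<lambda>s. ramp a b l r s * p' s + (r - l) / (b - a) * p s) has_integral
      (ramp a b l r b * p b - ramp a b l r a * p a)) {a..b}"
    using ab by (intro fundamental_theorem_of_calculus) auto
  then show ?thesis using ab by (simp add: integral_unique ramp_simps)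
qed

text \<open>One half of Green's formula: integrate along the first coordinate, then along the
  edge.\<close>

lemma integral_ramp_grad_fst:
  assumes "a < b" and v: "C_k (Suc 0) v"
  shows "integral (cbox (a, c) (b, d)) (\<lambda>z. ramp a b l r (fst z) * fst (grad v z) + (r - l) / (b - a) * v z) =
    r * integral {c..d} (\<lambda>t. v (b, t)) - l * integral {c..d} (\<lambda>t. v (a, t))" (is "integral _ ?F = _")
proof -
  have F: "continuous_on (cbox (a, c) (b, d)) ?F"
    by (intro continuous_intros C_k_Suc_continuous[OF v])
  \<comment> \<open>Fubini delivers the s-integral outside; the order is swapped so that the
    one-dimensional formula applies to the inner integral.\<close>
  have "continuous_on (cbox (a, c) (b, d)) (\<lambda>(s, t). ?F (s, t))"
    using F by (simp add: case_prod_unfold)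
  from integral_swap_continuous[OF this]
  have "integral (cbox (a, c) (b, d)) ?F = integral {c..d} (\<lambda>t. integral {a..b} (\<lambda>s. ?F (s, t)))"
    unfolding integral_prod_continuous[OF F] by simp
  also have "\<dots> = integral {c..d} (\<lambda>t. r * v (b, t) - l * v (a, t))"
    using integral_ramp_mult[OF \<open>a < b\<close> C_k_partial_derivatives(1)[OF v], of l r] by simp
  also have "\<dots> = integral {c..d} (\<lambda>t. r * v (b, t)) - integral {c..d} (\<lambda>t. l * v (a, t))"
    by (intro integral_diff integrable_continuous_interval continuous_intros
        continuous_on_compose2[OF C_k_Suc_continuous(1)[OF v, of UNIV]]) auto
  finally show ?thesis by simp
qed

lemma integral_ramp_grad_snd:
  assumes "c < d" and v: "C_k (Suc 0) v"
  shows "integral (cbox (a, c) (b, d)) (\<lambda>z. ramp c d l r (snd z) * snd (grad v z) + (r - l) / (d - c) * v z) =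
    r * integral {a..b} (\<lambda>s. v (s, d)) - l * integral {a..b} (\<lambda>s. v (s, c))" (is "integral _ ?F = _")
proof -
  have F: "continuous_on (cbox (a, c) (b, d)) ?F"
    by (intro continuous_intros C_k_Suc_continuous[OF v])
  have "integral (cbox (a, c) (b, d)) ?F = integral {a..b} (\<lambda>s. integral {c..d} (\<lambda>t. ?F (s, t)))"
    unfolding integral_prod_continuous[OF F] by simp
  also have "\<dots> = integral {a..b} (\<lambda>s. r * v (s, d) - l * v (s, c))"
    using integral_ramp_mult[OF \<open>c < d\<close> C_k_partial_derivatives(2)[OF v], of l r] by simp
  also have "\<dots> = integral {a..b} (\<lambda>s. r * v (s, d)) - integral {a..b} (\<lambda>s. l * v (s, c))"
    by (intro integral_diff integrable_continuous_interval continuous_intros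
        continuous_on_compose2[OF C_k_Suc_continuous(1)[OF v, of UNIV]]) auto
  finally show ?thesis by simp
qed

section \<open>Inner products of L2 functions\<close>

lemma L2_inner_integrable:
  fixes u v :: "point \<Rightarrow> 'b::euclidean_space"
  assumes "u \<in> L2_space \<Omega>" "v \<in> L2_space \<Omega>"
  shows "integrable (lebesgue_on \<Omega>) (\<lambda>z. u z \<bullet> v z)"
proof (rule Bochner_Integration.integrable_bound)
  show "integrable (lebesgue_on \<Omega>) (\<lambda>z. (norm (u z))\<^sup>2 + (norm (v z))\<^sup>2)"
    using assms by (auto simp: L2_space_def)
  show "(\<lambda>z. u z \<bullet> v z) \<in> borel_measurable (lebesgue_on \<Omega>)"
    using assms by (auto simp: L2_space_def)
  have "norm (u z \<bullet> v z) \<le> norm ((norm (u z))\<^sup>2 + (norm (v z))\<^sup>2)" for z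
  proof -
    have "\<bar>u z \<bullet> v z\<bar> \<le> norm (u z) * norm (v z)" by (rule Cauchy_Schwarz_ineq2)
    also have "\<dots> \<le> (norm (u z))\<^sup>2 + (norm (v z))\<^sup>2"
      using sum_squares_bound[of "norm (u z)" "norm (v z)"]
        mult_nonneg_nonneg[OF norm_ge_zero[of "u z"] norm_ge_zero[of "v z"]] by linarith
    finally show ?thesis by simp
  qed
  then show "AE z in lebesgue_on \<Omega>. norm (u z \<bullet> v z) \<le> norm ((norm (u z))\<^sup>2 + (norm (v z))\<^sup>2)" by simp
qed

lemma L2_space_diff:
  fixes u v :: "point \<Rightarrow> 'b::euclidean_space"
  assumes "u \<in> L2_space \<Omega>" "v \<in> L2_space \<Omega>"
  shows "(\<lambda>z. u z - v z) \<in> L2_space \<Omega>"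
proof -
  have "integrable (lebesgue_on \<Omega>) (\<lambda>z. u z \<bullet> u z + v z \<bullet> v z - 2 * (u z \<bullet> v z))"
    using assms by (intro Bochner_Integration.integrable_diff Bochner_Integration.integrable_add
        integrable_mult_right L2_inner_integrable)
  moreover have "(\<lambda>z. u z \<bullet> u z + v z \<bullet> v z - 2 * (u z \<bullet> v z)) = (\<lambda>z. (norm (u z - v z))\<^sup>2)"
    by (simp add: fun_eq_iff power2_norm_eq_inner inner_diff inner_commute)
  ultimately show ?thesis using assms by (auto simp: L2_space_def)
qed

lemma L2_inner_diff_left:
  fixes u v w :: "point \<Rightarrow> 'b::euclidean_space"
  assumes "u \<in> L2_space \<Omega>" "v \<in> L2_space \<Omega>" "w \<in> L2_space \<Omega>"
  shows "L2_inner \<Omega> (\<lambda>z. u z - v z) w = L2_inner \<Omega> u w - L2_inner \<Omega> v w"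
  unfolding L2_inner_def inner_diff_left
  using assms by (intro Bochner_Integration.integral_diff L2_inner_integrable)

lemma L2_inner_commute: "L2_inner \<Omega> u v = L2_inner \<Omega> v u"
  by (simp add: L2_inner_def inner_commute)

lemma L2_inner_self_eq_0:
  fixes u :: "point \<Rightarrow> 'b::euclidean_space"
  assumes "u \<in> L2_space \<Omega>" "L2_inner \<Omega> u u = 0"
  shows "AE z in lebesgue_on \<Omega>. u z = 0"
proof -
  have "AE z in lebesgue_on \<Omega>. u z \<bullet> u z = 0"
    using assms(2) unfolding L2_inner_def
    by (subst integral_nonneg_eq_0_iff_AE[symmetric]) (auto intro: L2_inner_integrable assms)
  then show ?thesis by simp
qed

text \<open>\<open>proj0\<close> is fixed only up to null sets, so equations containing it must
  tolerate such changes.\<close>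

lemma L2_inner_cong_AE:
  fixes u u' v :: "point \<Rightarrow> 'b::euclidean_space"
  assumes "u \<in> L2_space \<Omega>" "u' \<in> L2_space \<Omega>" "v \<in> L2_space \<Omega>" "AE z in lebesgue_on \<Omega>. u z = u' z"
  shows "L2_inner \<Omega> u v = L2_inner \<Omega> u' v"
  unfolding L2_inner_def
  using assms by (intro integral_cong_AE) (auto simp: L2_space_def)

lemma cbox_Pair_real: "cbox (a, c) (b, d) = {a..b} \<times> {c..(d::real)}" for a b :: real
  by (simp add: cbox_Pair_eq)

lemma integral_eq_zeroI: "(\<And>t. t \<in> S \<Longrightarrow> f t = 0) \<Longrightarrow> integral S f = 0"
  by (intro integral_unique has_integral_is_0)

section \<open>Squares inside open sets and positions in a grid\<close>

lemma open_prod_contains_square: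
  assumes "open W" "(s, t) \<in> W"
  obtains \<epsilon> :: real where "\<epsilon> > 0" "cbox (s - \<epsilon>, t - \<epsilon>) (s + \<epsilon>, t + \<epsilon>) \<subseteq> (W :: point set)"
proof -
  obtain U V where UV: "open U" "open V" "s \<in> U" "t \<in> V" "U \<times> V \<subseteq> W"
    using assms by (metis mem_Sigma_iff open_prod_elim)
  obtain \<epsilon>1 \<epsilon>2 where "\<epsilon>1 > 0" "cball s \<epsilon>1 \<subseteq> U" "\<epsilon>2 > 0" "cball t \<epsilon>2 \<subseteq> V"
    using UV open_contains_cball by metis
  then have "{s - min \<epsilon>1 \<epsilon>2..s + min \<epsilon>1 \<epsilon>2} \<subseteq> U" "{t - min \<epsilon>1 \<epsilon>2..t + min \<epsilon>1 \<epsilon>2} \<subseteq> V"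
    unfolding cball_eq_atLeastAtMost
    by (auto elim!: order_trans[rotated] simp: atLeastatMost_subset_iff)
  then have "cbox (s - min \<epsilon>1 \<epsilon>2, t - min \<epsilon>1 \<epsilon>2) (s + min \<epsilon>1 \<epsilon>2, t + min \<epsilon>1 \<epsilon>2) \<subseteq> W"
    using UV(5) unfolding cbox_Pair_real by blast
  with that[of "min \<epsilon>1 \<epsilon>2"] \<open>\<epsilon>1 > 0\<close> \<open>\<epsilon>2 > 0\<close> show thesis by simp
qed

text \<open>An endpoint lies in the closure of the open interval, so each neighbourhood of it
  contains inner points. This serves to replace a vertex by an inner point of an edge.\<close>

lemma open_vimage_interval_point:
  fixes g :: "real \<Rightarrow> 'a::topological_space"
  assumes "open W" "continuous_on UNIV g" "g t \<in> W" "a \<le> t" "t \<le> b" "a < b"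
  obtains t' where "a < t'" "t' < b" "g t' \<in> W"
proof -
  have "open (g -` W)" using assms(1,2) by (simp add: open_vimage)
  moreover have "t \<in> closure {a<..<b}" using assms by simp
  ultimately have "g -` W \<inter> {a<..<b} \<noteq> {}"
    using assms(3) by (metis IntI disjoint_iff open_Int_closure_eq_empty vimageI2)
  then show thesis using that by auto
qed

text \<open>Locates the cell of a point slightly beyond the grid line i. The guard on the last
  premise admits the outer line i = n, where the other premises contradict each other; in this way
  the existence of a neighbour is obtained instead of assumed.\<close>

lemma grid_index_right:
  fixes g :: "nat \<Rightarrow> real"
  assumes "strict_mono_on {0..n} g" "i \<le> n" "1 \<le> m" "m \<le> n"
    and "g (m - 1) \<le> s" "s \<le> g m" "g i < s" "i < n \<Longrightarrow> s < g (i + 1)"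
  shows "m = i + 1"
proof -
  have "g i < g m" using assms by linarith
  then have "i < m" using assms strict_mono_on_less[OF assms(1)] by simp
  then have "g (m - 1) < g (i + 1)" using assms by linarith
  then have "m - 1 < i + 1" using assms \<open>i < m\<close> strict_mono_on_less[OF assms(1)] by simp
  with \<open>i < m\<close> show ?thesis by simp
qed

lemma grid_index_left:
  fixes g :: "nat \<Rightarrow> real"
  assumes "strict_mono_on {0..n} g" "i \<le> n" "1 \<le> m" "m \<le> n"
    and "g (m - 1) \<le> s" "s \<le> g m" "s < g i" "0 < i \<Longrightarrow> g (i - 1) < s"
  shows "m = i"
proof -
  have "g (m - 1) < g i" using assms by linarith
  then have "m - 1 < i" using assms strict_mono_on_less[OF assms(1)] by simp
  then have "g (i - 1) < g m" using assms by linarith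
  then have "i - 1 < m" using assms \<open>m - 1 < i\<close> strict_mono_on_less[OF assms(1)] by simp
  with \<open>m - 1 < i\<close> show ?thesis using assms by linarith
qed

lemma grid_small_step:
  fixes g :: "nat \<Rightarrow> real"
  assumes "strict_mono_on {0..n} g" "i \<le> n" "\<epsilon> > 0"
  obtains \<delta> where "0 < \<delta>" "\<delta> \<le> \<epsilon>" "i < n \<Longrightarrow> g i + \<delta> < g (i + 1)" "0 < i \<Longrightarrow> g (i - 1) < g i - \<delta>"
proof -
  have a: "i < n \<Longrightarrow> g i < g (i + 1)" and b: "0 < i \<Longrightarrow> g (i - 1) < g i"
    using assms strict_mono_on_less[OF assms(1)] by simp_all
  \<comment> \<open>Half of the adjacent gap keeps the step strictly inside it; beyond an outer grid
    line there is no gap, and 1 is a default.\<close>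
  define \<delta>1 where "\<delta>1 = (if i < n then (g (i + 1) - g i) / 2 else 1)"
  define \<delta>2 where "\<delta>2 = (if 0 < i then (g i - g (i - 1)) / 2 else 1)"
  define \<delta> where "\<delta> = min \<epsilon> (min \<delta>1 \<delta>2)"
  have \<delta>: "\<delta> \<le> \<epsilon>" "\<delta> \<le> \<delta>1" "\<delta> \<le> \<delta>2" by (simp_all add: \<delta>_def)
  have pos: "0 < \<delta>" using a b assms(3) by (auto simp: \<delta>_def \<delta>1_def \<delta>2_def)
  have "g i + \<delta> < g (i + 1)" if "i < n"
    using a[OF that] \<delta>(2)[unfolded \<delta>1_def if_P[OF that]] by (simp add: field_simps)
  moreover have "g (i - 1) < g i - \<delta>" if "0 < i"
    using b[OF that] \<delta>(3)[unfolded \<delta>2_def if_P[OF that]] by (simp add: field_simps)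
  ultimately show thesis using that pos \<delta>(1) by blast
qed

section \<open>Edge integrals, and gradients of cell polynomials\<close>

lemma edge_integral_cong:
  assumes "\<And>z. z \<in> closed_segment (fst e) (snd e) \<Longrightarrow> g z = h z"
  shows "edge_integral e g = edge_integral e h"
proof -
  have "integral {0..1} (\<lambda>t. g (linepath (fst e) (snd e) t)) = integral {0..1} (\<lambda>t. h (linepath (fst e) (snd e) t))"
    by (intro integral_cong assms) (simp add: linepath_in_path)
  then show ?thesis by (simp add: edge_integral_def)
qed

lemma edge_integral_diff:
  assumes "continuous_on UNIV g" "continuous_on UNIV h"
  shows "edge_integral e (\<lambda>z. g z - h z) = edge_integral e g - edge_integral e h"
proof -
  have "continuous_on {0..1} (\<lambda>t. g (linepath (fst e) (snd e) t))" "continuous_on {0..1} (\<lambda>t. h (linepath (fst e) (snd e) t))"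
    by (intro continuous_on_compose2[OF assms(1)] continuous_on_compose2[OF assms(2)] continuous_on_linepath; simp)+
  then have "integral {0..1} (\<lambda>t. g (linepath (fst e) (snd e) t) - h (linepath (fst e) (snd e) t)) =
      integral {0..1} (\<lambda>t. g (linepath (fst e) (snd e) t)) - integral {0..1} (\<lambda>t. h (linepath (fst e) (snd e) t))"
    by (intro integral_diff integrable_continuous_interval)
  then show ?thesis by (simp add: edge_integral_def right_diff_distrib)
qed

lemma edge_integral_const: "edge_integral e (\<lambda>z. c) = dist (fst e) (snd e) * c"
  by (simp add: edge_integral_def)

text \<open>The length factor in \<open>edge_integral\<close> is the Jacobian of the parametrisation
  of an edge by [0, 1].\<close>

lemma integral_rescale_01:
  fixes h :: "real \<Rightarrow> real"
  assumes "c < d" "continuous_on {c..d} h"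
  shows "(d - c) * integral {0..1} (\<lambda>t. h (c + t * (d - c))) = integral {c..d} h"
proof -
  have "(h has_integral integral {c..d} h) (cbox c d)"
    using assms by (simp add: integrable_continuous_interval integrable_integral)
  from has_integral_affinity'[OF this, of "d - c" c]
  have "((\<lambda>t. h (c + t * (d - c))) has_integral (integral {c..d} h / (d - c))) {0..1}"
    using assms(1) by (simp add: mult.commute add.commute divide_inverse)
  then show ?thesis using assms(1) by (simp add: integral_unique)
qed

lemma edge_integral_vertical:
  assumes "c < d" "continuous_on UNIV v"
  shows "edge_integral ((a, c), (a, d)) v = integral {c..d} (\<lambda>t. v (a, t))"
proof -
  have "linepath (a, c) (a, d) t = (a, c + t * (d - c))" for t
    by (simp add: linepath_def algebra_simps)
  moreover have "continuous_on {c..d} (\<lambda>t. v (a, t))"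
    by (intro continuous_on_compose2[OF assms(2)] continuous_intros) auto
  ultimately show ?thesis
    using integral_rescale_01[of c d "\<lambda>t. v (a, t)"] assms(1)
    by (simp add: edge_integral_def dist_Pair_Pair dist_real_def)
qed

lemma edge_integral_horizontal:
  assumes "a < b" "continuous_on UNIV v"
  shows "edge_integral ((a, c), (b, c)) v = integral {a..b} (\<lambda>s. v (s, c))"
proof -
  have "linepath (a, c) (b, c) t = (a + t * (b - a), c)" for t
    by (simp add: linepath_def algebra_simps)
  moreover have "continuous_on {a..b} (\<lambda>s. v (s, c))"
    by (intro continuous_on_compose2[OF assms(2)] continuous_intros) auto
  ultimately show ?thesis
    using integral_rescale_01[of a b "\<lambda>s. v (s, c)"] assms(1)
    by (simp add: edge_integral_def dist_Pair_Pair dist_real_def)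
qed

text \<open>\<open>frechet_derivative\<close> is a choice among all derivatives at the point, so the
  gradients agree once exactly the same maps are derivatives of u and of v.\<close>

lemma grad_cong_open:
  assumes "open S" "z \<in> S" "\<And>w. w \<in> S \<Longrightarrow> u w = v w"
  shows "grad u z = grad v z"
proof -
  have "(u has_derivative D) (at z) \<longleftrightarrow> (v has_derivative D) (at z)" for D
    using assms has_derivative_transform_within_open[of u D z UNIV S v]
      has_derivative_transform_within_open[of v D z UNIV S u] by auto
  then show ?thesis by (simp add: grad_def frechet_derivative_def)
qed

lemma EQ_poly_has_derivative:
  fixes p :: "point \<Rightarrow> real"
  assumes "\<forall>s t. p (s, t) = c\<^sub>0 + c\<^sub>1 * s + c\<^sub>2 * t + c\<^sub>3 * s\<^sup>2 + c\<^sub>4 * t\<^sup>2"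
  shows "(p has_derivative (\<lambda>h. (c\<^sub>1 + 2 * c\<^sub>3 * fst z) * fst h + (c\<^sub>2 + 2 * c\<^sub>4 * snd z) * snd h)) (at z)"
proof -
  have "p = (\<lambda>z. c\<^sub>0 + c\<^sub>1 * fst z + c\<^sub>2 * snd z + c\<^sub>3 * (fst z)\<^sup>2 + c\<^sub>4 * (snd z)\<^sup>2)"
    using assms by (simp add: fun_eq_iff)
  moreover have "((\<lambda>z. c\<^sub>0 + c\<^sub>1 * fst (z::point) + c\<^sub>2 * snd z + c\<^sub>3 * (fst z)\<^sup>2 + c\<^sub>4 * (snd z)\<^sup>2) has_derivative
      (\<lambda>h. (c\<^sub>1 + 2 * c\<^sub>3 * fst z) * fst h + (c\<^sub>2 + 2 * c\<^sub>4 * snd z) * snd h)) (at z)"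
    by (auto intro!: derivative_eq_intros simp: algebra_simps)
  ultimately show ?thesis by simp
qed

lemma EQ_poly_C_k:
  assumes "p \<in> EQ_poly"
  shows "C_k (Suc 0) p"
proof -
  obtain c\<^sub>0 c\<^sub>1 c\<^sub>2 c\<^sub>3 c\<^sub>4 where "\<forall>s t. p (s, t) = c\<^sub>0 + c\<^sub>1 * s + c\<^sub>2 * t + c\<^sub>3 * s\<^sup>2 + c\<^sub>4 * t\<^sup>2"
    using assms unfolding EQ_poly_def by blast
  from C_k_SucI[OF EQ_poly_has_derivative[OF this]] show ?thesis
    by (simp del: C_k.simps(2) add: continuous_intros)
qed

section \<open>Rectangular meshes\<close>

locale rect_mesh =
  fixes \<Omega> :: "point set" and n\<^sub>1 n\<^sub>2 :: nat and x y :: "nat \<Rightarrow> real" and T :: "point set set"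
  assumes open_domain: "open \<Omega>" and bounded_domain: "bounded \<Omega>"
    and mono_x: "strict_mono_on {0..n\<^sub>1} x" and mono_y: "strict_mono_on {0..n\<^sub>2} y"
    and T_grid: "T = grid_mesh \<Omega> n\<^sub>1 x n\<^sub>2 y"
    and closure_domain: "closure \<Omega> = \<Union>T" and interior_cells: "\<forall>K\<in>T. interior K \<subseteq> \<Omega>"
begin

text \<open>A cell carries the index of its upper right grid point, as in \<open>grid_mesh\<close>;
  hence indices start at 1, and neighbours differ by 1 in one component.\<close>

definition cell :: "nat \<times> nat \<Rightarrow> point set" where
  "cell k = cbox (x (fst k - 1), y (snd k - 1)) (x (fst k), y (snd k))"

definition ocell :: "nat \<times> nat \<Rightarrow> point set" where
  "ocell k = box (x (fst k - 1), y (snd k - 1)) (x (fst k), y (snd k))"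

definition cells :: "(nat \<times> nat) set" where
  "cells = {k \<in> {1..n\<^sub>1} \<times> {1..n\<^sub>2}. cell k \<subseteq> closure \<Omega>}"

lemma x_less_iff: "i \<le> n\<^sub>1 \<Longrightarrow> j \<le> n\<^sub>1 \<Longrightarrow> x i < x j \<longleftrightarrow> i < j"
  using strict_mono_on_less[OF mono_x] by simp

lemma y_less_iff: "i \<le> n\<^sub>2 \<Longrightarrow> j \<le> n\<^sub>2 \<Longrightarrow> y i < y j \<longleftrightarrow> i < j"
  using strict_mono_on_less[OF mono_y] by simp

lemma x_le_iff: "i \<le> n\<^sub>1 \<Longrightarrow> j \<le> n\<^sub>1 \<Longrightarrow> x i \<le> x j \<longleftrightarrow> i \<le> j"
  using strict_mono_on_less_eq[OF mono_x] by simp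

lemma y_le_iff: "i \<le> n\<^sub>2 \<Longrightarrow> j \<le> n\<^sub>2 \<Longrightarrow> y i \<le> y j \<longleftrightarrow> i \<le> j"
  using strict_mono_on_less_eq[OF mono_y] by simp

lemma x_eq_iff: "i \<le> n\<^sub>1 \<Longrightarrow> j \<le> n\<^sub>1 \<Longrightarrow> x i = x j \<longleftrightarrow> i = j"
  using x_le_iff by (metis order_antisym order_refl)

lemma y_eq_iff: "i \<le> n\<^sub>2 \<Longrightarrow> j \<le> n\<^sub>2 \<Longrightarrow> y i = y j \<longleftrightarrow> i = j"
  using y_le_iff by (metis order_antisym order_refl)

lemma finite_cells: "finite cells"
  by (rule finite_subset[of _ "{1..n\<^sub>1} \<times> {1..n\<^sub>2}"]) (auto simp: cells_def)

lemma cells_bounds: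
  assumes "k \<in> cells"
  shows "1 \<le> fst k" "fst k \<le> n\<^sub>1" "1 \<le> snd k" "snd k \<le> n\<^sub>2"
  using assms by (auto simp: cells_def)

lemma cells_less:
  assumes "k \<in> cells"
  shows "x (fst k - 1) < x (fst k)" "y (snd k - 1) < y (snd k)"
  using cells_bounds[OF assms] by (auto simp: x_less_iff y_less_iff)

lemma mem_cell:
  "(s, t) \<in> cell k \<longleftrightarrow> x (fst k - 1) \<le> s \<and> s \<le> x (fst k) \<and> y (snd k - 1) \<le> t \<and> t \<le> y (snd k)"
  by (auto simp: cell_def cbox_Pair_eq)

lemma cell_eq: "cell k = {x (fst k - 1)..x (fst k)} \<times> {y (snd k - 1)..y (snd k)}"
  by (simp add: cell_def cbox_Pair_eq)

lemma interior_cell: "interior (cell k) = ocell k"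
  by (simp add: cell_def ocell_def interior_cbox)

lemma mem_ocell:
  "(s, t) \<in> ocell k \<longleftrightarrow> x (fst k - 1) < s \<and> s < x (fst k) \<and> y (snd k - 1) < t \<and> t < y (snd k)"
  unfolding interior_cell[symmetric] cell_eq interior_Times by (simp add: conj_assoc)

lemma T_eq: "T = cell ` cells"
proof -
  have "T = {K. \<exists>i\<in>{1..n\<^sub>1}. \<exists>j\<in>{1..n\<^sub>2}. K = cell (i, j) \<and> K \<subseteq> closure \<Omega>}"
    unfolding T_grid grid_mesh_def cell_eq fst_conv snd_conv ..
  also have "\<dots> = cell ` cells"
    unfolding cells_def by blast
  finally show ?thesis .
qed

lemma ocell_subset: "k \<in> cells \<Longrightarrow> ocell k \<subseteq> \<Omega>"
  using interior_cells by (auto simp: T_eq interior_cell)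

lemma ocell_subset_cell: "ocell k \<subseteq> cell k"
  using interior_cell interior_subset by metis

lemma closure_eq: "closure \<Omega> = \<Union>(cell ` cells)"
  by (simp add: closure_domain T_eq)

text \<open>One of the two cells may be closed: the strict inequalities from the open one force the
  two index intervals to overlap, and intervals between consecutive integers overlap only if they
  coincide.\<close>

lemma ocell_inj:
  assumes "k \<in> cells" "m \<in> cells" "z \<in> ocell k" "z \<in> cell m"
  shows "k = m"
proof -
  obtain s t where z: "z = (s, t)" by (cases z)
  have "x (fst k - 1) < x (fst m)" "x (fst m - 1) < x (fst k)" "y (snd k - 1) < y (snd m)" "y (snd m - 1) < y (snd k)"
    using assms(3,4) by (auto simp: z mem_cell mem_ocell)
  then show ?thesis
    using cells_bounds[OF assms(1)] cells_bounds[OF assms(2)]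
    by (auto simp: x_less_iff y_less_iff prod_eq_iff)
qed

definition skeleton :: "point set" where
  "skeleton = (\<Union>k\<in>cells. cell k - ocell k)"

lemma negligible_skeleton: "negligible skeleton"
  unfolding skeleton_def cell_def ocell_def
  by (intro negligible_Union) (auto simp: finite_cells negligible_frontier_interval)

lemma domain_cases:
  assumes "z \<in> \<Omega>" "z \<notin> skeleton"
  obtains k where "k \<in> cells" "z \<in> ocell k"
proof -
  have "z \<in> \<Union>(cell ` cells)" using assms(1) closure_subset[of \<Omega>] closure_eq by blast
  then show thesis using that assms(2) by (auto simp: skeleton_def)
qed

lemma domain_sets: "\<Omega> \<in> sets lebesgue"
  using open_domain by auto

lemma AE_cells: "AE z in lebesgue_on \<Omega>. \<exists>k\<in>cells. z \<in> ocell k"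
proof -
  have "AE z in lebesgue. z \<notin> skeleton"
    using negligible_skeleton by (simp add: negligible_iff_null_sets AE_not_in)
  then show ?thesis
    using domain_sets by (auto simp: AE_restrict_space_iff elim!: eventually_mono intro: domain_cases)
qed

text \<open>g is known in the open cells only, and \<open>G k\<close> extends it continuously to the
  closed cell; what lies outside the open cells is a null set.\<close>

lemma integral_cells:
  fixes g :: "point \<Rightarrow> 'b::euclidean_space"
  assumes G: "\<And>k. k \<in> cells \<Longrightarrow> continuous_on (cell k) (G k)"
    and g: "\<And>k z. k \<in> cells \<Longrightarrow> z \<in> ocell k \<Longrightarrow> g z = G k z"
  shows "integrable (lebesgue_on \<Omega>) g"
    and "integral\<^sup>L (lebesgue_on \<Omega>) g = (\<Sum>k\<in>cells. integral (cell k) (G k))"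
proof -
  have neg: "negligible (cell k - ocell k)" for k
    unfolding cell_def ocell_def by (rule negligible_frontier_interval)
  have abs: "g absolutely_integrable_on cell k" if "k \<in> cells" for k
  proof -
    have "G k absolutely_integrable_on cell k"
      using G[OF that] unfolding cell_def by (rule absolutely_integrable_continuous)
    then show ?thesis
      by (rule absolutely_integrable_spike[OF _ neg[of k]]) (use g that in auto)
  qed
  have "\<Omega> \<subseteq> closure \<Omega>" by (rule closure_subset)
  have "g absolutely_integrable_on (\<Union>k\<in>cells. cell k)"
    using finite_cells abs by (intro set_integrable_UN) (auto simp: cell_def)
  then have abs\<Omega>: "g absolutely_integrable_on \<Omega>"
    by (rule set_integrable_subset) (use domain_sets \<open>\<Omega> \<subseteq> closure \<Omega>\<close> closure_eq in auto)
  then show int: "integrable (lebesgue_on \<Omega>) g"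
    using domain_sets by (simp add: integrable_restrict_space set_integrable_def)
  have "(g has_integral integral (cell k) (G k)) (cell k)" if "k \<in> cells" for k
  proof (rule has_integral_spike[OF neg[of k]])
    show "(G k has_integral integral (cell k) (G k)) (cell k)"
      using G[OF that] unfolding cell_def by (intro integrable_integral integrable_continuous)
  qed (use g that in auto)
  then have "(g has_integral (\<Sum>k\<in>cells. integral (cell k) (G k))) (\<Union>(cell ` cells))"
  proof (intro has_integral_UN finite_cells)
    show "pairwise (\<lambda>k m. negligible (cell k \<inter> cell m)) cells"
    proof (rule pairwiseI)
      fix k m assume "k \<in> cells" "m \<in> cells" "k \<noteq> m"
      then have "cell k \<inter> cell m \<subseteq> cell k - ocell k" using ocell_inj by blast
      then show "negligible (cell k \<inter> cell m)" using neg negligible_subset by blast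
    qed
  qed
  then have "(g has_integral (\<Sum>k\<in>cells. integral (cell k) (G k))) (closure \<Omega>)"
    by (simp only: closure_eq)
  \<comment> \<open>A closure point lies in some closed cell; if it is outside the domain, it cannot
    lie in the open cell.\<close>
  moreover have "closure \<Omega> - \<Omega> \<subseteq> skeleton"
  proof
    fix z assume z: "z \<in> closure \<Omega> - \<Omega>"
    then obtain k where "k \<in> cells" "z \<in> cell k" using closure_eq by blast
    with z ocell_subset show "z \<in> skeleton" unfolding skeleton_def by blast
  qed
  then have "negligible {z \<in> closure \<Omega> - \<Omega>. g z \<noteq> 0}" "negligible {z \<in> \<Omega> - closure \<Omega>. g z \<noteq> 0}"
    using \<open>\<Omega> \<subseteq> closure \<Omega>\<close> by (auto intro!: negligible_subset[OF negligible_skeleton])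
  ultimately have "(g has_integral (\<Sum>k\<in>cells. integral (cell k) (G k))) \<Omega>"
    using has_integral_spike_set_eq by blast
  then show "integral\<^sup>L (lebesgue_on \<Omega>) g = (\<Sum>k\<in>cells. integral (cell k) (G k))"
    using lebesgue_integral_eq_integral[OF int domain_sets] by (simp add: integral_unique)
qed

lemma L2_cells:
  fixes g :: "point \<Rightarrow> 'b::euclidean_space"
  assumes G: "\<And>k. k \<in> cells \<Longrightarrow> continuous_on (cell k) (G k)"
    and g: "\<And>k z. k \<in> cells \<Longrightarrow> z \<in> ocell k \<Longrightarrow> g z = G k z"
  shows "g \<in> L2_space \<Omega>"
proof -
  have "integrable (lebesgue_on \<Omega>) g"
    by (rule integral_cells(1)[OF G g])
  moreover have "integrable (lebesgue_on \<Omega>) (\<lambda>z. (norm (g z))\<^sup>2)"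
    by (rule integral_cells(1)[where G="\<lambda>k z. (norm (G k z))\<^sup>2"]) (auto intro!: continuous_intros G simp: g)
  ultimately show ?thesis by (simp add: L2_space_def)
qed

lemma L2_inner_cells:
  fixes u v :: "point \<Rightarrow> 'b::euclidean_space"
  assumes "\<And>k. k \<in> cells \<Longrightarrow> continuous_on (cell k) (U k)" "\<And>k z. k \<in> cells \<Longrightarrow> z \<in> ocell k \<Longrightarrow> u z = U k z"
    and "\<And>k. k \<in> cells \<Longrightarrow> continuous_on (cell k) (V k)" "\<And>k z. k \<in> cells \<Longrightarrow> z \<in> ocell k \<Longrightarrow> v z = V k z"
  shows "L2_inner \<Omega> u v = (\<Sum>k\<in>cells. integral (cell k) (\<lambda>z. U k z \<bullet> V k z))"
  unfolding L2_inner_def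
  by (rule integral_cells(2)) (auto intro!: continuous_intros assms simp: assms)

text \<open>Open cells are disjoint, so the sum has at most one nonzero term. On the cell
  boundaries, a null set, the value is 0.\<close>

definition cellwise :: "(nat \<times> nat \<Rightarrow> point \<Rightarrow> 'b) \<Rightarrow> point \<Rightarrow> 'b::euclidean_space" where
  "cellwise G z = (\<Sum>k\<in>cells. if z \<in> ocell k then G k z else 0)"

lemma cellwise_eq:
  assumes "k \<in> cells" "z \<in> ocell k"
  shows "cellwise G z = G k z"
proof -
  have "cellwise G z = (\<Sum>m\<in>cells. if m = k then G m z else 0)"
    unfolding cellwise_def
  proof (rule sum.cong)
    fix m assume "m \<in> cells"
    then have "z \<in> ocell m \<longleftrightarrow> m = k" using assms ocell_inj ocell_subset_cell by blast
    then show "(if z \<in> ocell m then G m z else 0) = (if m = k then G m z else 0)" by simp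
  qed simp
  then show ?thesis using finite_cells assms by simp
qed

lemma cellwise_L2:
  fixes G :: "nat \<times> nat \<Rightarrow> point \<Rightarrow> 'b::euclidean_space"
  assumes "\<And>k. k \<in> cells \<Longrightarrow> continuous_on (cell k) (G k)"
  shows "cellwise G \<in> L2_space \<Omega>"
  by (rule L2_cells[where G=G]) (simp_all add: assms cellwise_eq)

section \<open>Weak divergence of Raviart-Thomas fields\<close>

text \<open>Side integrals in coordinates, the form in which they leave Green's formula;
  \<open>edge_integral_sides\<close> relates them to \<open>edge_integral\<close>.\<close>

definition edge_right :: "(point \<Rightarrow> real) \<Rightarrow> nat \<times> nat \<Rightarrow> real" where
  "edge_right v k = integral {y (snd k - 1)..y (snd k)} (\<lambda>t. v (x (fst k), t))"

definition edge_left :: "(point \<Rightarrow> real) \<Rightarrow> nat \<times> nat \<Rightarrow> real" where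
  "edge_left v k = integral {y (snd k - 1)..y (snd k)} (\<lambda>t. v (x (fst k - 1), t))"

definition edge_top :: "(point \<Rightarrow> real) \<Rightarrow> nat \<times> nat \<Rightarrow> real" where
  "edge_top v k = integral {x (fst k - 1)..x (fst k)} (\<lambda>s. v (s, y (snd k)))"

definition edge_bottom :: "(point \<Rightarrow> real) \<Rightarrow> nat \<times> nat \<Rightarrow> real" where
  "edge_bottom v k = integral {x (fst k - 1)..x (fst k)} (\<lambda>s. v (s, y (snd k - 1)))"

lemmas edge_defs = edge_right_def edge_left_def edge_top_def edge_bottom_def

text \<open>\<open>l k\<close>, \<open>r k\<close>, \<open>b k\<close>, \<open>t k\<close> are the normal components on the left, right, bottom and top edge.\<close>

definition rt :: "(nat \<times> nat \<Rightarrow> real) \<Rightarrow> (nat \<times> nat \<Rightarrow> real) \<Rightarrow> (nat \<times> nat \<Rightarrow> real) \<Rightarrow> (nat \<times> nat \<Rightarrow> real) \<Rightarrow>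
    nat \<times> nat \<Rightarrow> point \<Rightarrow> point" where
  "rt l r b t k z = (ramp (x (fst k - 1)) (x (fst k)) (l k) (r k) (fst z),
                     ramp (y (snd k - 1)) (y (snd k)) (b k) (t k) (snd z))"

text \<open>The elementwise divergence of \<open>rt\<close>, a constant on each cell.\<close>

definition rt_div :: "(nat \<times> nat \<Rightarrow> real) \<Rightarrow> (nat \<times> nat \<Rightarrow> real) \<Rightarrow> (nat \<times> nat \<Rightarrow> real) \<Rightarrow> (nat \<times> nat \<Rightarrow> real) \<Rightarrow>
    nat \<times> nat \<Rightarrow> real" where
  "rt_div l r b t k = (r k - l k) / (x (fst k) - x (fst k - 1)) + (t k - b k) / (y (snd k) - y (snd k - 1))"

text \<open>The sum over the cells of the boundary integrals of v times the outward normal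
  component. The minus signs come from the outward normals on the left and at the bottom. The family
  v may have different traces from the two sides of an edge.\<close>

definition bdry :: "(nat \<times> nat \<Rightarrow> real) \<Rightarrow> (nat \<times> nat \<Rightarrow> real) \<Rightarrow> (nat \<times> nat \<Rightarrow> real) \<Rightarrow> (nat \<times> nat \<Rightarrow> real) \<Rightarrow>
    (nat \<times> nat \<Rightarrow> point \<Rightarrow> real) \<Rightarrow> real" where
  "bdry l r b t v = (\<Sum>k\<in>cells. (r k * edge_right (v k) k - l k * edge_left (v k) k) +
     (t k * edge_top (v k) k - b k * edge_bottom (v k) k))"

lemma continuous_on_rt: "continuous_on S (rt l r b t k)"
  unfolding rt_def by (intro continuous_intros)

text \<open>Each component of \<open>rt\<close> depends on its own coordinate only, so the two ramp
  formulas add up to Green's formula.\<close>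

lemma green_cell:
  assumes k: "k \<in> cells" and v: "C_k (Suc 0) v"
  shows "integral (cell k) (\<lambda>z. rt l r b t k z \<bullet> grad v z) + integral (cell k) (\<lambda>z. rt_div l r b t k * v z) =
    (r k * edge_right v k - l k * edge_left v k) + (t k * edge_top v k - b k * edge_bottom v k)"
proof -
  let ?a = "x (fst k - 1)" and ?b = "x (fst k)" and ?c = "y (snd k - 1)" and ?d = "y (snd k)"
  note cont = continuous_intros continuous_on_rt C_k_Suc_continuous[OF v]
  have "integral (cell k) (\<lambda>z. rt l r b t k z \<bullet> grad v z) + integral (cell k) (\<lambda>z. rt_div l r b t k * v z)
     = integral (cell k) (\<lambda>z. rt l r b t k z \<bullet> grad v z + rt_div l r b t k * v z)"
    unfolding cell_def by (intro integral_add[symmetric] integrable_continuous cont)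
  also have "\<dots> = integral (cell k) (\<lambda>z.
      (ramp ?a ?b (l k) (r k) (fst z) * fst (grad v z) + (r k - l k) / (?b - ?a) * v z) +
      (ramp ?c ?d (b k) (t k) (snd z) * snd (grad v z) + (t k - b k) / (?d - ?c) * v z))"
    by (rule arg_cong[where f="integral _"]) (simp add: fun_eq_iff rt_def rt_div_def inner_prod_def distrib_right)
  also have "\<dots> = integral (cell k) (\<lambda>z. ramp ?a ?b (l k) (r k) (fst z) * fst (grad v z) + (r k - l k) / (?b - ?a) * v z) +
      integral (cell k) (\<lambda>z. ramp ?c ?d (b k) (t k) (snd z) * snd (grad v z) + (t k - b k) / (?d - ?c) * v z)"
    unfolding cell_def by (intro integral_add integrable_continuous cont)
  also have "\<dots> = (r k * edge_right v k - l k * edge_left v k) + (t k * edge_top v k - b k * edge_bottom v k)"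
    unfolding cell_def edge_defs
      integral_ramp_grad_fst[OF cells_less(1)[OF k] v] integral_ramp_grad_snd[OF cells_less(2)[OF k] v] ..
  finally show ?thesis .
qed

lemma green:
  assumes "\<And>k. k \<in> cells \<Longrightarrow> C_k (Suc 0) (v k)"
  shows "(\<Sum>k\<in>cells. integral (cell k) (\<lambda>z. rt l r b t k z \<bullet> grad (v k) z)) +
    (\<Sum>k\<in>cells. integral (cell k) (\<lambda>z. rt_div l r b t k * v k z)) = bdry l r b t v"
  unfolding bdry_def sum.distrib[symmetric] using assms by (intro sum.cong green_cell) auto

lemma RT_space_cells:
  assumes "\<tau> \<in> RT_space \<Omega> T"
  obtains l r b t where "\<And>k z. k \<in> cells \<Longrightarrow> z \<in> ocell k \<Longrightarrow> \<tau> z = rt l r b t k z"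
proof -
  have "\<exists>A B C D. \<forall>z\<in>ocell k. \<tau> z = (ramp (x (fst k - 1)) (x (fst k)) A B (fst z),
      ramp (y (snd k - 1)) (y (snd k)) C D (snd z))" if k: "k \<in> cells" for k
  proof -
    \<comment> \<open>Every affine function is the ramp through its own values at a' and b'.\<close>
    have affine: "(p + q * s) = ramp a' b' (p + q * a') (p + q * b') s" if "a' < b'" for p q s a' b' :: real
    proof -
      have "(p + q * b' - (p + q * a')) / (b' - a') = q" using that by (simp add: field_simps)
      then show ?thesis by (simp add: ramp_def algebra_simps)
    qed
    obtain p q where pq: "p \<in> Q_poly 1 0" "q \<in> Q_poly 0 1" "\<forall>z\<in>ocell k. \<tau> z = (p z, q z)"
      using assms k unfolding RT_space_def T_eq by (auto simp: interior_cell)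
    obtain c where "\<forall>s t. p (s, t) = (\<Sum>i\<le>1. \<Sum>j\<le>0. c i j * s ^ i * t ^ j)"
      using pq(1) unfolding Q_poly_def by blast
    then have c: "p (s, t) = c 0 0 + c 1 0 * s" for s t by simp
    obtain c' where "\<forall>s t. q (s, t) = (\<Sum>i\<le>0. \<Sum>j\<le>1. c' i j * s ^ i * t ^ j)"
      using pq(2) unfolding Q_poly_def by blast
    then have c': "q (s, t) = c' 0 0 + c' 0 1 * t" for s t by simp
    have "\<forall>z\<in>ocell k. \<tau> z = (c 0 0 + c 1 0 * fst z, c' 0 0 + c' 0 1 * snd z)"
      using pq(3) c c' by auto
    then show ?thesis
      using affine[OF cells_less(1)[OF k]] affine[OF cells_less(2)[OF k]] by metis
  qed
  then obtain l r b t where "\<forall>k\<in>cells. \<forall>z\<in>ocell k. \<tau> z = (ramp (x (fst k - 1)) (x (fst k)) (l k) (r k) (fst z),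
      ramp (y (snd k - 1)) (y (snd k)) (b k) (t k) (snd z))"
    by metis
  with that show thesis by (simp add: rt_def)
qed

lemma P0_space_cells:
  assumes "v \<in> P0_space \<Omega> T"
  obtains c where "\<And>k z. k \<in> cells \<Longrightarrow> z \<in> ocell k \<Longrightarrow> v z = c k"
proof -
  have "\<forall>k\<in>cells. \<exists>c. \<forall>z\<in>ocell k. v z = c"
    using assms unfolding P0_space_def T_eq by (auto simp: interior_cell)
  then show thesis using that by metis
qed

lemma P0_spaceI:
  assumes "\<And>k z. k \<in> cells \<Longrightarrow> z \<in> ocell k \<Longrightarrow> v z = c k"
  shows "v \<in> P0_space \<Omega> T"
proof -
  have "v \<in> L2_space \<Omega>" by (rule L2_cells[where G="\<lambda>k z. c k"]) (simp_all add: assms)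
  then show ?thesis using assms unfolding P0_space_def T_eq by (auto simp: interior_cell)
qed

lemma test_functionD:
  assumes "\<phi> \<in> test_functions \<Omega>"
  shows "C_k k \<phi>" "z \<notin> \<Omega> \<Longrightarrow> \<phi> z = 0" "\<phi> \<in> L2_space \<Omega>"
proof -
  show C: "C_k k \<phi>" for k using assms by (simp add: test_functions_def)
  show "z \<notin> \<Omega> \<Longrightarrow> \<phi> z = 0"
    using assms closure_subset[of "{z. \<phi> z \<noteq> 0}"] by (auto simp: test_functions_def)
  show "\<phi> \<in> L2_space \<Omega>"
    using C_k_continuous[OF C[of 0]]
    by (intro L2_cells[where G="\<lambda>k. \<phi>"]) (auto intro: continuous_on_subset)
qed

text \<open>Integration by parts cell by cell leaves the elementwise divergence and a boundary sum,
  whereas the definition of the weak divergence has no boundary sum; subtracting gives the identity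
  behind all tests with bumps.\<close>

lemma weak_div_defect:
  assumes \<tau>: "\<And>k z. k \<in> cells \<Longrightarrow> z \<in> ocell k \<Longrightarrow> \<tau> z = rt l r b t k z"
    and d: "has_weak_div \<Omega> \<tau> d" and \<phi>: "\<phi> \<in> test_functions \<Omega>"
  shows "L2_inner \<Omega> (\<lambda>z. d z - cellwise (\<lambda>k z. rt_div l r b t k) z) \<phi> = - bdry l r b t (\<lambda>k. \<phi>)"
proof -
  let ?D = "cellwise (\<lambda>k z. rt_div l r b t k)"
  note C = test_functionD(1)[OF \<phi>]
  have D: "?D \<in> L2_space \<Omega>" by (intro cellwise_L2) simp
  have "L2_inner \<Omega> \<tau> (grad \<phi>) = (\<Sum>k\<in>cells. integral (cell k) (\<lambda>z. rt l r b t k z \<bullet> grad \<phi> z))"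
    by (rule L2_inner_cells) (simp_all add: \<tau> continuous_on_rt C_k_Suc_continuous(4)[OF C])
  moreover have "L2_inner \<Omega> ?D \<phi> = (\<Sum>k\<in>cells. integral (cell k) (\<lambda>z. rt_div l r b t k \<bullet> \<phi> z))"
    by (rule L2_inner_cells) (simp_all add: cellwise_eq C_k_Suc_continuous(1)[OF C])
  moreover have "L2_inner \<Omega> \<tau> (grad \<phi>) = - L2_inner \<Omega> d \<phi>"
    using d \<phi> by (auto simp: has_weak_div_def)
  moreover have "L2_inner \<Omega> (\<lambda>z. d z - ?D z) \<phi> = L2_inner \<Omega> d \<phi> - L2_inner \<Omega> ?D \<phi>"
    using d by (intro L2_inner_diff_left D test_functionD(3)[OF \<phi>]) (simp add: has_weak_div_def)
  ultimately show ?thesis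
    using green[of "\<lambda>k. \<phi>" l r b t] C by simp
qed

text \<open>Dominated convergence with majorant |e|, which is integrable because constants are in L2
  of the domain. Convergence is asked in the open cells only, so the bumps may behave differently on
  the edges.\<close>

lemma L2_inner_test_limit:
  assumes e: "e \<in> L2_space \<Omega>" and \<phi>: "\<And>n. \<phi> n \<in> test_functions \<Omega>" "\<And>n z. \<bar>\<phi> n z\<bar> \<le> 1"
    and h: "h \<in> borel_measurable (lebesgue_on \<Omega>)"
    and lim: "\<And>k z. k \<in> cells \<Longrightarrow> z \<in> ocell k \<Longrightarrow> (\<lambda>n. \<phi> n z) \<longlonglongrightarrow> h z"
  shows "(\<lambda>n. L2_inner \<Omega> e (\<phi> n)) \<longlonglongrightarrow> L2_inner \<Omega> e h"
  unfolding L2_inner_def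
proof (rule integral_dominated_convergence[where w="\<lambda>z. \<bar>e z\<bar>"])
  show "(\<lambda>z. e z \<bullet> h z) \<in> borel_measurable (lebesgue_on \<Omega>)"
    using e h by (auto simp: L2_space_def)
  show "(\<lambda>z. e z \<bullet> \<phi> n z) \<in> borel_measurable (lebesgue_on \<Omega>)" for n
    using e test_functionD(3)[OF \<phi>(1)[of n]] by (auto simp: L2_space_def)
  have "(\<lambda>z. 1) \<in> L2_space \<Omega>" by (rule L2_cells[where G="\<lambda>k z. 1"]) simp_all
  from L2_inner_integrable[OF e this] show "integrable (lebesgue_on \<Omega>) (\<lambda>z. \<bar>e z\<bar>)"
    by (simp add: integrable_abs)
  show "AE z in lebesgue_on \<Omega>. (\<lambda>n. e z \<bullet> \<phi> n z) \<longlonglongrightarrow> e z \<bullet> h z"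
    using AE_cells by eventually_elim (auto intro!: tendsto_intros lim)
  show "AE z in lebesgue_on \<Omega>. norm (e z \<bullet> \<phi> n z) \<le> \<bar>e z\<bar>" for n
    using \<phi>(2) by (auto simp: abs_mult intro!: mult_left_le)
qed

lemma bdry_cong:
  assumes "\<And>k z. k \<in> cells \<Longrightarrow> z \<in> cell k - ocell k \<Longrightarrow> v k z = w k z"
  shows "bdry l r b t v = bdry l r b t w"
proof -
  have "edge_right (v k) k = edge_right (w k) k \<and> edge_left (v k) k = edge_left (w k) k \<and>
    edge_top (v k) k = edge_top (w k) k \<and> edge_bottom (v k) k = edge_bottom (w k) k" if k: "k \<in> cells" for k
    unfolding edge_defs
    using cells_less[OF k] by (intro conjI integral_cong assms k) (auto simp: mem_cell mem_ocell)
  then show ?thesis unfolding bdry_def by simp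
qed

lemma bdry_0: "bdry l r b t (\<lambda>k z. 0) = 0"
  by (simp add: bdry_def edge_defs)

text \<open>Bumps supported inside the open cell have no boundary sum, so the defect is orthogonal
  to all of them and hence to their limit, the indicator.\<close>

lemma weak_div_cell:
  assumes \<tau>: "\<And>k z. k \<in> cells \<Longrightarrow> z \<in> ocell k \<Longrightarrow> \<tau> z = rt l r b t k z"
    and d: "has_weak_div \<Omega> \<tau> d" and k: "k \<in> cells"
  shows "L2_inner \<Omega> (\<lambda>z. d z - cellwise (\<lambda>k z. rt_div l r b t k) z) (indicator (ocell k)) = 0"
proof -
  define e where "e = (\<lambda>z. d z - cellwise (\<lambda>k z. rt_div l r b t k) z)"
  define a a' c c' where "a = x (fst k - 1)" "a' = x (fst k)" "c = y (snd k - 1)" "c' = y (snd k)"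
  note abbr = a_a'_c_c'_def
  \<comment> \<open>The support is inset by 1 / \<open>q n\<close>, because it must be a compact
    part of the domain and the cell boundary need not lie in the domain. The slope
    \<open>q n\<close> grows at the same rate, so the bumps still tend to 1 at every point of the
    open cell.\<close>
  define q where "q n = real (Suc n)" for n
  define \<delta> where "\<delta> n = 1 / q n" for n
  define \<phi> where "\<phi> n = bump (q n) (a + \<delta> n) (a' - \<delta> n) (q n) (c + \<delta> n) (c' - \<delta> n)" for n
  have q: "q n > 0" for n by (simp add: q_def)
  then have \<delta>: "\<delta> n > 0" for n by (simp add: \<delta>_def)
  have sub: "cbox (a + \<delta> n, c + \<delta> n) (a' - \<delta> n, c' - \<delta> n) \<subseteq> ocell k" for n
  proof
    fix z assume "z \<in> cbox (a + \<delta> n, c + \<delta> n) (a' - \<delta> n, c' - \<delta> n)"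
    then show "z \<in> ocell k" using \<delta>[of n] by (cases z) (auto simp: cbox_Pair_eq mem_ocell abbr)
  qed
  have test: "\<phi> n \<in> test_functions \<Omega>" for n
    unfolding \<phi>_def using sub ocell_subset[OF k] by (intro bump_test_function q) blast
  have zero: "\<phi> n z = 0" if "z \<notin> ocell k" for n z
    unfolding \<phi>_def using that \<delta>[of n] by (intro bump_eq_0 q) (cases z, auto simp: mem_ocell abbr)
  have e: "e \<in> L2_space \<Omega>"
    unfolding e_def using d by (intro L2_space_diff cellwise_L2) (auto simp: has_weak_div_def)
  have "(\<lambda>n. L2_inner \<Omega> e (\<phi> n)) \<longlonglongrightarrow> L2_inner \<Omega> e (indicator (ocell k))"
  proof (rule L2_inner_test_limit[OF e test])
    show "\<bar>\<phi> n z\<bar> \<le> 1" for n z unfolding \<phi>_def by (simp add: bump_bounds)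
    have "ocell k \<in> sets lebesgue" by (simp add: ocell_def)
    then show "indicator (ocell k) \<in> borel_measurable (lebesgue_on \<Omega>)"
      by (simp add: measurable_restrict_space1)
    fix m z assume m: "m \<in> cells" "z \<in> ocell m"
    show "(\<lambda>n. \<phi> n z) \<longlonglongrightarrow> indicator (ocell k) z"
    proof (cases "z \<in> ocell k")
      case False
      then show ?thesis by (simp add: zero)
    next
      case True
      then have pos: "fst z - a > 0" "a' - fst z > 0" "snd z - c > 0" "c' - snd z > 0"
        by (cases z, simp add: mem_ocell abbr)+
      \<comment> \<open>As \<open>q n\<close> times \<delta> n is 1, all four arguments take the
        affine form of \<open>expinv_0_tendsto_1\<close>, and inside the cell the coefficient of n
        is positive.\<close>
      have "q n * (s - (u + \<delta> n)) = s - u - 1 + (s - u) * real n"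
        "q n * ((u - \<delta> n) - s) = u - s - 1 + (u - s) * real n" for n s u
        using q[of n] by (simp_all add: \<delta>_def q_def field_simps)
      then have "(\<lambda>n. \<phi> n z) \<longlonglongrightarrow> 1 * 1 * (1 * 1)"
        unfolding \<phi>_def bump_def by (simp only:) (intro tendsto_intros expinv_0_tendsto_1 pos)
      then show ?thesis using True by simp
    qed
  qed
  moreover have "L2_inner \<Omega> e (\<phi> n) = 0" for n
  proof -
    have "L2_inner \<Omega> e (\<phi> n) = - bdry l r b t (\<lambda>m. \<phi> n)"
      unfolding e_def by (rule weak_div_defect[OF \<tau> d test])
    also have "bdry l r b t (\<lambda>m. \<phi> n) = bdry l r b t (\<lambda>m z. 0)"
      using ocell_inj k by (intro bdry_cong zero) blast
    finally show ?thesis by (simp add: bdry_0)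
  qed
  ultimately have "(\<lambda>n. 0) \<longlonglongrightarrow> L2_inner \<Omega> e (indicator (ocell k))" by simp
  then show ?thesis unfolding e_def by (simp add: LIMSEQ_const_iff)
qed

text \<open>Nothing is known about the values of d inside a cell, but v is almost everywhere a
  combination of cell indicators, and the defect is orthogonal to each of these.\<close>

lemma weak_div_P0:
  assumes \<tau>: "\<And>k z. k \<in> cells \<Longrightarrow> z \<in> ocell k \<Longrightarrow> \<tau> z = rt l r b t k z"
    and d: "has_weak_div \<Omega> \<tau> d" and v: "v \<in> P0_space \<Omega> T"
  shows "L2_inner \<Omega> d v = L2_inner \<Omega> (cellwise (\<lambda>k z. rt_div l r b t k)) v"
proof -
  define e where "e = (\<lambda>z. d z - cellwise (\<lambda>k z. rt_div l r b t k) z)"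
  have D: "cellwise (\<lambda>k z. rt_div l r b t k) \<in> L2_space \<Omega>" by (intro cellwise_L2) simp
  have d2: "d \<in> L2_space \<Omega>" using d by (simp add: has_weak_div_def)
  have v2: "v \<in> L2_space \<Omega>" using v by (simp add: P0_space_def)
  have e: "e \<in> L2_space \<Omega>" unfolding e_def by (rule L2_space_diff[OF d2 D])
  obtain c where c: "\<And>k z. k \<in> cells \<Longrightarrow> z \<in> ocell k \<Longrightarrow> v z = c k"
    using P0_space_cells[OF v] by metis
  have ind: "(indicator (ocell k) :: point \<Rightarrow> real) \<in> L2_space \<Omega>" for k
  proof -
    have s: "ocell k \<in> sets lebesgue" by (simp add: ocell_def)
    have "(indicator (ocell k) :: point \<Rightarrow> real) \<in> borel_measurable (lebesgue_on \<Omega>)"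
      using s by (simp add: measurable_restrict_space1)
    moreover have "integrable (lebesgue_on \<Omega>) (\<lambda>z. (norm (indicator (ocell k) z :: real))\<^sup>2)"
    proof (rule Bochner_Integration.integrable_bound)
      show "integrable (lebesgue_on \<Omega>) (\<lambda>z. 1 :: real)"
        by (rule integral_cells(1)[where G="\<lambda>k z. 1"]) simp_all
      show "(\<lambda>z. (norm (indicator (ocell k) z :: real))\<^sup>2) \<in> borel_measurable (lebesgue_on \<Omega>)"
      proof -
        have "(\<lambda>z. (norm (indicator (ocell k) z :: real))\<^sup>2) = indicator (ocell k)"
          by (simp add: fun_eq_iff indicator_def)
        with calculation show ?thesis by simp
      qed
    qed (simp add: indicator_def)
    ultimately show ?thesis by (simp add: L2_space_def)
  qed
  have "L2_inner \<Omega> e v = (\<integral>z. (\<Sum>k\<in>cells. c k * (e z \<bullet> indicator (ocell k) z)) \<partial>lebesgue_on \<Omega>)"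
    unfolding L2_inner_def
  proof (rule integral_cong_AE)
    show "(\<lambda>z. e z \<bullet> v z) \<in> borel_measurable (lebesgue_on \<Omega>)"
      using L2_inner_integrable[OF e v2] by simp
    show "(\<lambda>z. \<Sum>k\<in>cells. c k * (e z \<bullet> indicator (ocell k) z)) \<in> borel_measurable (lebesgue_on \<Omega>)"
      using L2_inner_integrable[OF e ind]
      by (intro borel_measurable_sum borel_measurable_times borel_measurable_const) (rule borel_measurable_integrable)
    show "AE z in lebesgue_on \<Omega>. e z \<bullet> v z = (\<Sum>k\<in>cells. c k * (e z \<bullet> indicator (ocell k) z))"
      using AE_cells
    proof eventually_elim
      case (elim z)
      then obtain m where m: "m \<in> cells" "z \<in> ocell m" by blast
      have "(\<Sum>k\<in>cells. c k * (e z \<bullet> indicator (ocell k) z)) = (\<Sum>k\<in>cells. if k = m then c k * e z else 0)"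
      proof (rule sum.cong)
        fix k assume "k \<in> cells"
        then have "z \<in> ocell k \<longleftrightarrow> k = m" using m ocell_inj ocell_subset_cell by blast
        then show "c k * (e z \<bullet> indicator (ocell k) z) = (if k = m then c k * e z else 0)"
          by (simp add: indicator_def)
      qed simp
      then show ?case using m finite_cells by (simp add: c[OF m])
    qed
  qed
  also have "\<dots> = (\<Sum>k\<in>cells. c k * L2_inner \<Omega> e (indicator (ocell k)))"
    unfolding L2_inner_def using L2_inner_integrable[OF e ind]
    by (subst Bochner_Integration.integral_sum) auto
  also have "\<dots> = 0"
    using weak_div_cell[OF \<tau> d] by (simp add: e_def)
  finally show ?thesis
    using L2_inner_diff_left[OF d2 D v2] by (simp add: e_def)
qed

section \<open>Continuity of normal components\<close>

lemma cell_containing: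
  assumes "(s, t) \<in> \<Omega>"
  obtains m where "m \<in> cells" "1 \<le> fst m" "fst m \<le> n\<^sub>1" "1 \<le> snd m" "snd m \<le> n\<^sub>2"
    "x (fst m - 1) \<le> s" "s \<le> x (fst m)" "y (snd m - 1) \<le> t" "t \<le> y (snd m)"
proof -
  have "(s, t) \<in> \<Union>(cell ` cells)" using assms closure_subset closure_eq by blast
  then show thesis using that cells_bounds by (auto simp: mem_cell)
qed

text \<open>Around an inner point of the edge a square fits into the domain. The points shifted to
  the right and to the left of the edge then belong to closed cells, and their coordinates leave
  only the indices (i + 1, j) and (i, j).\<close>

lemma vertical_edge_neighbourhood:
  assumes i: "i \<le> n\<^sub>1" and j: "1 \<le> j" "j \<le> n\<^sub>2"
    and z: "(x i, t\<^sub>0) \<in> \<Omega>" "y (j - 1) \<le> t\<^sub>0" "t\<^sub>0 \<le> y j"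
  obtains \<epsilon> t where "(i, j) \<in> cells" "(i + 1, j) \<in> cells" "\<epsilon> > 0"
    "cbox (x i - \<epsilon>, t - \<epsilon>) (x i + \<epsilon>, t + \<epsilon>) \<subseteq> \<Omega>"
    "cbox (x i - \<epsilon>, t - \<epsilon>) (x i + \<epsilon>, t + \<epsilon>) \<subseteq> {x (i - 1)<..<x (i + 1)} \<times> {y (j - 1)<..<y j}"
proof -
  have "y (j - 1) < y j" using j by (simp add: y_less_iff)
  \<comment> \<open>The given point may be a vertex; openness of the domain yields a point strictly
    inside the edge.\<close>
  then obtain t where t: "y (j - 1) < t" "t < y j" "(x i, t) \<in> \<Omega>"
    using open_vimage_interval_point[OF open_domain continuous_on_Pair[OF continuous_on_const continuous_on_id] z]
    by blast
  have "open (\<Omega> \<inter> UNIV \<times> {y (j - 1)<..<y j})"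
    by (intro open_Int open_domain open_Times) auto
  then obtain \<epsilon>\<^sub>0 where \<epsilon>\<^sub>0: "\<epsilon>\<^sub>0 > 0"
      "cbox (x i - \<epsilon>\<^sub>0, t - \<epsilon>\<^sub>0) (x i + \<epsilon>\<^sub>0, t + \<epsilon>\<^sub>0) \<subseteq> \<Omega> \<inter> UNIV \<times> {y (j - 1)<..<y j}"
    using t open_prod_contains_square[of "\<Omega> \<inter> UNIV \<times> {y (j - 1)<..<y j}" "x i" t] by auto
  obtain \<epsilon> where \<epsilon>: "0 < \<epsilon>" "\<epsilon> \<le> \<epsilon>\<^sub>0" "i < n\<^sub>1 \<Longrightarrow> x i + \<epsilon> < x (i + 1)" "0 < i \<Longrightarrow> x (i - 1) < x i - \<epsilon>"
    using grid_small_step[OF mono_x i \<epsilon>\<^sub>0(1)] by blast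
  have "cbox (x i - \<epsilon>, t - \<epsilon>) (x i + \<epsilon>, t + \<epsilon>) \<subseteq> cbox (x i - \<epsilon>\<^sub>0, t - \<epsilon>\<^sub>0) (x i + \<epsilon>\<^sub>0, t + \<epsilon>\<^sub>0)"
    using \<epsilon>(2) by (auto simp: cbox_Pair_eq)
  with \<epsilon>\<^sub>0(2) have sub: "cbox (x i - \<epsilon>, t - \<epsilon>) (x i + \<epsilon>, t + \<epsilon>) \<subseteq> \<Omega> \<inter> UNIV \<times> {y (j - 1)<..<y j}"
    by (rule order_trans[rotated])
  have row: "snd m = j" if "1 \<le> snd m" "snd m \<le> n\<^sub>2" "y (snd m - 1) \<le> t" "t \<le> y (snd m)" for m :: "nat \<times> nat"
    using grid_index_left[OF mono_y j(2) that] t by simp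
  have "(x i + \<epsilon>, t) \<in> \<Omega>" "(x i - \<epsilon>, t) \<in> \<Omega>"
    using sub \<epsilon>(1) by (auto simp: cbox_Pair_eq subset_eq)
  obtain m where m: "m \<in> cells" "1 \<le> fst m" "fst m \<le> n\<^sub>1" "1 \<le> snd m" "snd m \<le> n\<^sub>2"
    "x (fst m - 1) \<le> x i + \<epsilon>" "x i + \<epsilon> \<le> x (fst m)" "y (snd m - 1) \<le> t" "t \<le> y (snd m)"
    using cell_containing[OF \<open>(x i + \<epsilon>, t) \<in> \<Omega>\<close>] by blast
  have "fst m = i + 1"
    using grid_index_right[OF mono_x i m(2,3,6,7)] \<epsilon> by simp
  with row[OF m(4,5,8,9)] m(1) have right: "(i + 1, j) \<in> cells" by (metis prod.collapse)
  obtain m where m: "m \<in> cells" "1 \<le> fst m" "fst m \<le> n\<^sub>1" "1 \<le> snd m" "snd m \<le> n\<^sub>2"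
    "x (fst m - 1) \<le> x i - \<epsilon>" "x i - \<epsilon> \<le> x (fst m)" "y (snd m - 1) \<le> t" "t \<le> y (snd m)"
    using cell_containing[OF \<open>(x i - \<epsilon>, t) \<in> \<Omega>\<close>] by blast
  have "fst m = i"
    using grid_index_left[OF mono_x i m(2,3,6,7)] \<epsilon> by simp
  with row[OF m(4,5,8,9)] m(1) have left: "(i, j) \<in> cells" by (metis prod.collapse)
  \<comment> \<open>Both neighbours exist, so the edge is not on an outer grid line and the guards
    in the choice of \<epsilon> are met.\<close>
  have "0 < i" "i < n\<^sub>1" using cells_bounds[OF left] cells_bounds[OF right] by auto
  show thesis
  proof (rule that[OF left right \<epsilon>(1)])
    show "cbox (x i - \<epsilon>, t - \<epsilon>) (x i + \<epsilon>, t + \<epsilon>) \<subseteq> \<Omega>" using sub by blast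
    have "{x i - \<epsilon>..x i + \<epsilon>} \<subseteq> {x (i - 1)<..<x (i + 1)}"
      using \<epsilon>(3)[OF \<open>i < n\<^sub>1\<close>] \<epsilon>(4)[OF \<open>0 < i\<close>] by auto
    with sub show "cbox (x i - \<epsilon>, t - \<epsilon>) (x i + \<epsilon>, t + \<epsilon>) \<subseteq> {x (i - 1)<..<x (i + 1)} \<times> {y (j - 1)<..<y j}"
      unfolding cbox_Pair_real by blast
  qed
qed

text \<open>The counterpart of \<open>vertical_edge_neighbourhood\<close> with the coordinates
  exchanged.\<close>

lemma horizontal_edge_neighbourhood:
  assumes j: "j \<le> n\<^sub>2" and i: "1 \<le> i" "i \<le> n\<^sub>1"
    and z: "(s\<^sub>0, y j) \<in> \<Omega>" "x (i - 1) \<le> s\<^sub>0" "s\<^sub>0 \<le> x i"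
  obtains \<epsilon> s where "(i, j) \<in> cells" "(i, j + 1) \<in> cells" "\<epsilon> > 0"
    "cbox (s - \<epsilon>, y j - \<epsilon>) (s + \<epsilon>, y j + \<epsilon>) \<subseteq> \<Omega>"
    "cbox (s - \<epsilon>, y j - \<epsilon>) (s + \<epsilon>, y j + \<epsilon>) \<subseteq> {x (i - 1)<..<x i} \<times> {y (j - 1)<..<y (j + 1)}"
proof -
  have "x (i - 1) < x i" using i by (simp add: x_less_iff)
  then obtain s where s: "x (i - 1) < s" "s < x i" "(s, y j) \<in> \<Omega>"
    using open_vimage_interval_point[OF open_domain continuous_on_Pair[OF continuous_on_id continuous_on_const] z]
    by blast
  have "open (\<Omega> \<inter> {x (i - 1)<..<x i} \<times> UNIV)"
    by (intro open_Int open_domain open_Times) auto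
  then obtain \<epsilon>\<^sub>0 where \<epsilon>\<^sub>0: "\<epsilon>\<^sub>0 > 0"
      "cbox (s - \<epsilon>\<^sub>0, y j - \<epsilon>\<^sub>0) (s + \<epsilon>\<^sub>0, y j + \<epsilon>\<^sub>0) \<subseteq> \<Omega> \<inter> {x (i - 1)<..<x i} \<times> UNIV"
    using s open_prod_contains_square[of "\<Omega> \<inter> {x (i - 1)<..<x i} \<times> UNIV" s "y j"] by auto
  obtain \<epsilon> where \<epsilon>: "0 < \<epsilon>" "\<epsilon> \<le> \<epsilon>\<^sub>0" "j < n\<^sub>2 \<Longrightarrow> y j + \<epsilon> < y (j + 1)" "0 < j \<Longrightarrow> y (j - 1) < y j - \<epsilon>"
    using grid_small_step[OF mono_y j \<epsilon>\<^sub>0(1)] by blast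
  have "cbox (s - \<epsilon>, y j - \<epsilon>) (s + \<epsilon>, y j + \<epsilon>) \<subseteq> cbox (s - \<epsilon>\<^sub>0, y j - \<epsilon>\<^sub>0) (s + \<epsilon>\<^sub>0, y j + \<epsilon>\<^sub>0)"
    using \<epsilon>(2) by (auto simp: cbox_Pair_eq)
  with \<epsilon>\<^sub>0(2) have sub: "cbox (s - \<epsilon>, y j - \<epsilon>) (s + \<epsilon>, y j + \<epsilon>) \<subseteq> \<Omega> \<inter> {x (i - 1)<..<x i} \<times> UNIV"
    by (rule order_trans[rotated])
  have column: "fst m = i" if "1 \<le> fst m" "fst m \<le> n\<^sub>1" "x (fst m - 1) \<le> s" "s \<le> x (fst m)" for m :: "nat \<times> nat"
    using grid_index_left[OF mono_x i(2) that] s by simp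
  have "(s, y j + \<epsilon>) \<in> \<Omega>" "(s, y j - \<epsilon>) \<in> \<Omega>"
    using sub \<epsilon>(1) by (auto simp: cbox_Pair_eq subset_eq)
  obtain m where m: "m \<in> cells" "1 \<le> fst m" "fst m \<le> n\<^sub>1" "1 \<le> snd m" "snd m \<le> n\<^sub>2"
    "x (fst m - 1) \<le> s" "s \<le> x (fst m)" "y (snd m - 1) \<le> y j + \<epsilon>" "y j + \<epsilon> \<le> y (snd m)"
    using cell_containing[OF \<open>(s, y j + \<epsilon>) \<in> \<Omega>\<close>] by blast
  have "snd m = j + 1"
    using grid_index_right[OF mono_y j m(4,5,8,9)] \<epsilon> by simp
  with column[OF m(2,3,6,7)] m(1) have top: "(i, j + 1) \<in> cells" by (metis prod.collapse)
  obtain m where m: "m \<in> cells" "1 \<le> fst m" "fst m \<le> n\<^sub>1" "1 \<le> snd m" "snd m \<le> n\<^sub>2"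
    "x (fst m - 1) \<le> s" "s \<le> x (fst m)" "y (snd m - 1) \<le> y j - \<epsilon>" "y j - \<epsilon> \<le> y (snd m)"
    using cell_containing[OF \<open>(s, y j - \<epsilon>) \<in> \<Omega>\<close>] by blast
  have "snd m = j"
    using grid_index_left[OF mono_y j m(4,5,8,9)] \<epsilon> by simp
  with column[OF m(2,3,6,7)] m(1) have bottom: "(i, j) \<in> cells" by (metis prod.collapse)
  have "0 < j" "j < n\<^sub>2" using cells_bounds[OF bottom] cells_bounds[OF top] by auto
  show thesis
  proof (rule that[OF bottom top \<epsilon>(1)])
    show "cbox (s - \<epsilon>, y j - \<epsilon>) (s + \<epsilon>, y j + \<epsilon>) \<subseteq> \<Omega>" using sub by blast
    have "{y j - \<epsilon>..y j + \<epsilon>} \<subseteq> {y (j - 1)<..<y (j + 1)}"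
      using \<epsilon>(3)[OF \<open>j < n\<^sub>2\<close>] \<epsilon>(4)[OF \<open>0 < j\<close>] by auto
    with sub show "cbox (s - \<epsilon>, y j - \<epsilon>) (s + \<epsilon>, y j + \<epsilon>) \<subseteq> {x (i - 1)<..<x i} \<times> {y (j - 1)<..<y (j + 1)}"
      unfolding cbox_Pair_real by blast
  qed
qed

text \<open>All boundary sums equal C, but up to sign they are pairings of a fixed L2 function with
  bumps that tend to 0.\<close>

lemma bdry_vanishing_limit:
  assumes \<tau>: "\<And>k z. k \<in> cells \<Longrightarrow> z \<in> ocell k \<Longrightarrow> \<tau> z = rt l r b t k z"
    and d: "has_weak_div \<Omega> \<tau> d"
    and \<phi>: "\<And>n. \<phi> n \<in> test_functions \<Omega>" "\<And>n z. \<bar>\<phi> n z\<bar> \<le> 1"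
    and lim: "\<And>k z. k \<in> cells \<Longrightarrow> z \<in> ocell k \<Longrightarrow> (\<lambda>n. \<phi> n z) \<longlonglongrightarrow> 0"
    and C: "\<And>n. bdry l r b t (\<lambda>k. \<phi> n) = C"
  shows "C = 0"
proof -
  define e where "e = (\<lambda>z. d z - cellwise (\<lambda>k z. rt_div l r b t k) z)"
  have e: "e \<in> L2_space \<Omega>"
    unfolding e_def using d by (intro L2_space_diff cellwise_L2) (auto simp: has_weak_div_def)
  have "(\<lambda>n. L2_inner \<Omega> e (\<phi> n)) \<longlonglongrightarrow> L2_inner \<Omega> e (\<lambda>z. 0)"
    by (rule L2_inner_test_limit[OF e \<phi>]) (simp_all add: lim)
  moreover have "L2_inner \<Omega> e (\<phi> n) = - C" for n
    using weak_div_defect[of \<tau> l r b t d "\<phi> n", OF \<tau> d \<phi>(1)] C by (simp add: e_def)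
  ultimately have "(\<lambda>n. - C) \<longlonglongrightarrow> 0" by (simp add: L2_inner_def)
  then show ?thesis by (simp add: LIMSEQ_const_iff)
qed

text \<open>Bumps that get thinner across the edge but keep their trace on it isolate the jump of
  the normal component: the boundary sum is this jump times a fixed nonzero number C.\<close>

lemma normal_continuity_vertical:
  assumes \<tau>: "\<And>k z. k \<in> cells \<Longrightarrow> z \<in> ocell k \<Longrightarrow> \<tau> z = rt l r b t k z"
    and d: "has_weak_div \<Omega> \<tau> d"
    and i: "i \<le> n\<^sub>1" and j: "1 \<le> j" "j \<le> n\<^sub>2"
    and z: "(x i, t\<^sub>0) \<in> \<Omega>" "y (j - 1) \<le> t\<^sub>0" "t\<^sub>0 \<le> y j"
  shows "r (i, j) = l (i + 1, j)"
proof -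
  obtain \<epsilon> \<theta> where cells: "(i, j) \<in> cells" "(i + 1, j) \<in> cells" and \<epsilon>: "\<epsilon> > 0"
    and sub: "cbox (x i - \<epsilon>, \<theta> - \<epsilon>) (x i + \<epsilon>, \<theta> + \<epsilon>) \<subseteq> \<Omega>"
    "cbox (x i - \<epsilon>, \<theta> - \<epsilon>) (x i + \<epsilon>, \<theta> + \<epsilon>) \<subseteq> {x (i - 1)<..<x (i + 1)} \<times> {y (j - 1)<..<y j}"
    using vertical_edge_neighbourhood[OF i j z] by blast
  \<comment> \<open>The half width 1 / \<open>q n\<close> times the slope \<open>q n\<close> is 1,
    so the values on the edge do not depend on n; the divisor \<epsilon> keeps the half width at
    most \<epsilon>.\<close>
  define q where "q n = real (Suc n) / \<epsilon>" for n
  define \<phi> where "\<phi> n = bump (q n) (x i - 1 / q n) (x i + 1 / q n) 1 (\<theta> - \<epsilon>) (\<theta> + \<epsilon>)" for n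
  define C where "C = integral {y (j - 1)..y j} (\<lambda>t. \<phi> 0 (x i, t))"
  have q: "q n > 0" for n using \<epsilon> by (simp add: q_def)
  have q_le: "1 / q n \<le> \<epsilon>" for n using \<epsilon> by (simp add: q_def field_simps)
  have test: "\<phi> n \<in> test_functions \<Omega>" for n
  proof -
    have "cbox (x i - 1 / q n, \<theta> - \<epsilon>) (x i + 1 / q n, \<theta> + \<epsilon>) \<subseteq> cbox (x i - \<epsilon>, \<theta> - \<epsilon>) (x i + \<epsilon>, \<theta> + \<epsilon>)"
      using q_le[of n] by (auto simp: cbox_Pair_eq)
    then show ?thesis unfolding \<phi>_def using sub(1) by (intro bump_test_function q) auto
  qed
  have zero: "\<phi> n (s, t) = 0" if "\<not> (x (i - 1) < s \<and> s < x (i + 1) \<and> y (j - 1) < t \<and> t < y j)" for n s t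
  proof -
    have "(s, t) \<notin> cbox (x i - \<epsilon>, \<theta> - \<epsilon>) (x i + \<epsilon>, \<theta> + \<epsilon>)"
      using subsetD[OF sub(2), of "(s, t)"] that by (metis greaterThanLessThan_iff mem_Sigma_iff)
    then show ?thesis
      unfolding \<phi>_def using q_le[of n] by (intro bump_eq_0 q) (auto simp: cbox_Pair_eq)
  qed
  have on_edge: "\<phi> n (x i, t) = \<phi> 0 (x i, t)" for n t
    unfolding \<phi>_def bump_def using q[of n] q[of 0] by simp
  have cont: "continuous_on UNIV (\<phi> n)" for n
    using C_k_continuous[OF test_functionD(1)[OF test, of 0]] .
  \<comment> \<open>The bump vanishes outside the open rectangle between the neighbouring grid
    lines; among all sides of all cells, only the two copies of this edge meet that
    rectangle.\<close>
  have column: "m = i" if "m \<le> n\<^sub>1" "x (i - 1) < x m" "x m < x (i + 1)" for m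
    using that cells_bounds[OF cells(2)] by (simp add: x_less_iff)
  have not_row: "\<not> (y (j - 1) < y m \<and> y m < y j)" if "m \<le> n\<^sub>2" for m
    using that cells_bounds[OF cells(2)] by (auto simp: y_less_iff)
  have row: "snd k = j" if "k \<in> cells" "y (snd k - 1) \<le> t" "t \<le> y (snd k)" "y (j - 1) < t" "t < y j" for k t
    using grid_index_left[OF mono_y j(2) cells_bounds(3,4)[OF that(1)] that(2,3)] that(4,5) by simp
  have right: "edge_right (\<phi> n) k = (if k = (i, j) then C else 0)" if k: "k \<in> cells" for n k
  proof (cases "k = (i, j)")
    case False
    have "\<phi> n (x (fst k), t) = 0" if t: "t \<in> {y (snd k - 1)..y (snd k)}" for t
      by (rule zero) (use column[OF cells_bounds(2)[OF k]] row[OF k] t False in \<open>auto simp: prod_eq_iff\<close>)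
    then show ?thesis unfolding edge_right_def if_not_P[OF False] by (rule integral_eq_zeroI)
  qed (simp add: edge_right_def C_def on_edge[of n])
  have left: "edge_left (\<phi> n) k = (if k = (i + 1, j) then C else 0)" if k: "k \<in> cells" for n k
  proof (cases "k = (i + 1, j)")
    case False
    have "\<phi> n (x (fst k - 1), t) = 0" if t: "t \<in> {y (snd k - 1)..y (snd k)}" for t
      by (rule zero) (use column[of "fst k - 1"] cells_bounds[OF k] row[OF k] t False in \<open>auto simp: prod_eq_iff\<close>)
    then show ?thesis unfolding edge_left_def if_not_P[OF False] by (rule integral_eq_zeroI)
  qed (simp add: edge_left_def C_def on_edge[of n])
  have top: "edge_top (\<phi> n) k = 0" and bottom: "edge_bottom (\<phi> n) k = 0" if k: "k \<in> cells" for n k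
  proof -
    have "\<phi> n (s, y (snd k)) = 0" "\<phi> n (s, y (snd k - 1)) = 0" for s
      using not_row[of "snd k"] not_row[of "snd k - 1"] cells_bounds[OF k] by (auto intro!: zero)
    then show "edge_top (\<phi> n) k = 0" "edge_bottom (\<phi> n) k = 0"
      by (simp_all add: edge_top_def edge_bottom_def)
  qed
  have "bdry l r b t (\<lambda>k. \<phi> n) = (r (i, j) - l (i + 1, j)) * C" for n
  proof -
    have "bdry l r b t (\<lambda>k. \<phi> n) =
        (\<Sum>k\<in>cells. (if k = (i, j) then r k * C else 0) - (if k = (i + 1, j) then l k * C else 0))"
      unfolding bdry_def by (intro sum.cong) (simp_all add: right left top bottom)
    also have "\<dots> = r (i, j) * C - l (i + 1, j) * C"
      using finite_cells cells by (simp add: sum_subtractf)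
    finally show ?thesis by (simp add: algebra_simps)
  qed
  moreover have "(\<lambda>n. \<phi> n z) \<longlonglongrightarrow> 0" if k: "k \<in> cells" "z \<in> ocell k" for k z
  proof -
    obtain s t where st: "z = (s, t)" by (cases z)
    \<comment> \<open>Off the grid line the bumps vanish as soon as 1 / \<open>q n\<close> falls
      below the distance to it.\<close>
    have "s \<noteq> x i"
      using k cells_bounds[OF k(1)] i by (auto simp: st mem_ocell x_less_iff)
    then have pos: "0 < \<bar>s - x i\<bar>" by simp
    obtain N where "\<epsilon> / \<bar>s - x i\<bar> < real N"
      using reals_Archimedean2 by blast
    then have N: "\<epsilon> < real N * \<bar>s - x i\<bar>" using pos by (simp add: pos_divide_less_eq)
    have "\<phi> n z = 0" if "n \<ge> N" for n
    proof -
      have "real N * \<bar>s - x i\<bar> \<le> real (Suc n) * \<bar>s - x i\<bar>"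
        using that by (intro mult_right_mono) auto
      with N have "\<epsilon> < \<bar>s - x i\<bar> * real (Suc n)" by (simp add: mult.commute)
      then have "1 / q n < \<bar>s - x i\<bar>" by (simp add: q_def pos_divide_less_eq)
      then show ?thesis unfolding \<phi>_def st by (intro bump_eq_0 q) auto
    qed
    then show ?thesis by (auto intro!: tendsto_eventually eventually_sequentiallyI)
  qed
  ultimately have "(r (i, j) - l (i + 1, j)) * C = 0"
    using bump_bounds by (intro bdry_vanishing_limit[OF \<tau> d test]) (auto simp: \<phi>_def)
  \<comment> \<open>A continuous nonnegative trace with integral 0 would vanish, but it is positive
    at \<theta>.\<close>
  moreover have "C \<noteq> 0"
  proof
    assume "C = 0"
    have "(x i, \<theta>) \<in> {x (i - 1)<..<x (i + 1)} \<times> {y (j - 1)<..<y j}"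
      using \<epsilon> by (intro subsetD[OF sub(2)]) (simp add: cbox_Pair_real)
    then have \<theta>: "\<theta> \<in> {y (j - 1)..y j}" by simp
    have "continuous_on {y (j - 1)..y j} (\<lambda>t. \<phi> 0 (x i, t))"
      by (intro continuous_on_compose2[OF cont] continuous_intros) auto
    then have "\<phi> 0 (x i, \<theta>) = 0"
      using \<open>C = 0\<close> \<theta> integral_eq_0_iff[of "y (j - 1)" "y j" "\<lambda>t. \<phi> 0 (x i, t)"] cells_less(2)[OF cells(1)]
      by (auto simp: C_def \<phi>_def bump_bounds)
    moreover have "\<phi> 0 (x i, \<theta>) > 0"
      unfolding \<phi>_def using q[of 0] \<epsilon> by (intro bump_pos) auto
    ultimately show False by simp
  qed
  ultimately show ?thesis by simp
qed

text \<open>The counterpart of \<open>normal_continuity_vertical\<close>, with the bumps narrowed in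
  the second coordinate.\<close>

lemma normal_continuity_horizontal:
  assumes \<tau>: "\<And>k z. k \<in> cells \<Longrightarrow> z \<in> ocell k \<Longrightarrow> \<tau> z = rt l r b t k z"
    and d: "has_weak_div \<Omega> \<tau> d"
    and j: "j \<le> n\<^sub>2" and i: "1 \<le> i" "i \<le> n\<^sub>1"
    and z: "(s\<^sub>0, y j) \<in> \<Omega>" "x (i - 1) \<le> s\<^sub>0" "s\<^sub>0 \<le> x i"
  shows "t (i, j) = b (i, j + 1)"
proof -
  obtain \<epsilon> \<theta> where cells: "(i, j) \<in> cells" "(i, j + 1) \<in> cells" and \<epsilon>: "\<epsilon> > 0"
    and sub: "cbox (\<theta> - \<epsilon>, y j - \<epsilon>) (\<theta> + \<epsilon>, y j + \<epsilon>) \<subseteq> \<Omega>"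
    "cbox (\<theta> - \<epsilon>, y j - \<epsilon>) (\<theta> + \<epsilon>, y j + \<epsilon>) \<subseteq> {x (i - 1)<..<x i} \<times> {y (j - 1)<..<y (j + 1)}"
    using horizontal_edge_neighbourhood[OF j i z] by blast
  define q where "q n = real (Suc n) / \<epsilon>" for n
  define \<phi> where "\<phi> n = bump 1 (\<theta> - \<epsilon>) (\<theta> + \<epsilon>) (q n) (y j - 1 / q n) (y j + 1 / q n)" for n
  define C where "C = integral {x (i - 1)..x i} (\<lambda>s. \<phi> 0 (s, y j))"
  have q: "q n > 0" for n using \<epsilon> by (simp add: q_def)
  have q_le: "1 / q n \<le> \<epsilon>" for n using \<epsilon> by (simp add: q_def field_simps)
  have test: "\<phi> n \<in> test_functions \<Omega>" for n
  proof -
    have "cbox (\<theta> - \<epsilon>, y j - 1 / q n) (\<theta> + \<epsilon>, y j + 1 / q n) \<subseteq> cbox (\<theta> - \<epsilon>, y j - \<epsilon>) (\<theta> + \<epsilon>, y j + \<epsilon>)"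
      using q_le[of n] by (auto simp: cbox_Pair_eq)
    then show ?thesis unfolding \<phi>_def using sub(1) by (intro bump_test_function q) auto
  qed
  have zero: "\<phi> n (s, t) = 0" if "\<not> (x (i - 1) < s \<and> s < x i \<and> y (j - 1) < t \<and> t < y (j + 1))" for n s t
  proof -
    have "(s, t) \<notin> cbox (\<theta> - \<epsilon>, y j - \<epsilon>) (\<theta> + \<epsilon>, y j + \<epsilon>)"
      using subsetD[OF sub(2), of "(s, t)"] that by (metis greaterThanLessThan_iff mem_Sigma_iff)
    then show ?thesis
      unfolding \<phi>_def using q_le[of n] by (intro bump_eq_0 q) (auto simp: cbox_Pair_eq)
  qed
  have on_edge: "\<phi> n (s, y j) = \<phi> 0 (s, y j)" for n s
    unfolding \<phi>_def bump_def using q[of n] q[of 0] by simp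
  have cont: "continuous_on UNIV (\<phi> n)" for n
    using C_k_continuous[OF test_functionD(1)[OF test, of 0]] .
  have row: "m = j" if "m \<le> n\<^sub>2" "y (j - 1) < y m" "y m < y (j + 1)" for m
    using that cells_bounds[OF cells(2)] by (simp add: y_less_iff)
  have not_column: "\<not> (x (i - 1) < x m \<and> x m < x i)" if "m \<le> n\<^sub>1" for m
    using that cells_bounds[OF cells(2)] by (auto simp: x_less_iff)
  have column: "fst k = i" if "k \<in> cells" "x (fst k - 1) \<le> s" "s \<le> x (fst k)" "x (i - 1) < s" "s < x i" for k s
    using grid_index_left[OF mono_x i(2) cells_bounds(1,2)[OF that(1)] that(2,3)] that(4,5) by simp
  have top: "edge_top (\<phi> n) k = (if k = (i, j) then C else 0)" if k: "k \<in> cells" for n k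
  proof (cases "k = (i, j)")
    case False
    have "\<phi> n (s, y (snd k)) = 0" if s: "s \<in> {x (fst k - 1)..x (fst k)}" for s
      by (rule zero) (use row[OF cells_bounds(4)[OF k]] column[OF k] s False in \<open>auto simp: prod_eq_iff\<close>)
    then show ?thesis unfolding edge_top_def if_not_P[OF False] by (rule integral_eq_zeroI)
  qed (simp add: edge_top_def C_def on_edge[of n])
  have bottom: "edge_bottom (\<phi> n) k = (if k = (i, j + 1) then C else 0)" if k: "k \<in> cells" for n k
  proof (cases "k = (i, j + 1)")
    case False
    have "\<phi> n (s, y (snd k - 1)) = 0" if s: "s \<in> {x (fst k - 1)..x (fst k)}" for s
      by (rule zero) (use row[of "snd k - 1"] cells_bounds[OF k] column[OF k] s False in \<open>auto simp: prod_eq_iff\<close>)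
    then show ?thesis unfolding edge_bottom_def if_not_P[OF False] by (rule integral_eq_zeroI)
  qed (simp add: edge_bottom_def C_def on_edge[of n])
  have right: "edge_right (\<phi> n) k = 0" and left: "edge_left (\<phi> n) k = 0" if k: "k \<in> cells" for n k
  proof -
    have "\<phi> n (x (fst k), t) = 0" "\<phi> n (x (fst k - 1), t) = 0" for t
      using not_column[of "fst k"] not_column[of "fst k - 1"] cells_bounds[OF k] by (auto intro!: zero)
    then show "edge_right (\<phi> n) k = 0" "edge_left (\<phi> n) k = 0"
      by (simp_all add: edge_right_def edge_left_def)
  qed
  have "bdry l r b t (\<lambda>k. \<phi> n) = (t (i, j) - b (i, j + 1)) * C" for n
  proof -
    have "bdry l r b t (\<lambda>k. \<phi> n) =
        (\<Sum>k\<in>cells. (if k = (i, j) then t k * C else 0) - (if k = (i, j + 1) then b k * C else 0))"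
      unfolding bdry_def by (intro sum.cong) (simp_all add: right left top bottom)
    also have "\<dots> = t (i, j) * C - b (i, j + 1) * C"
      using finite_cells cells by (simp add: sum_subtractf)
    finally show ?thesis by (simp add: algebra_simps)
  qed
  moreover have "(\<lambda>n. \<phi> n z) \<longlonglongrightarrow> 0" if k: "k \<in> cells" "z \<in> ocell k" for k z
  proof -
    obtain s t' where st: "z = (s, t')" by (cases z)
    have "t' \<noteq> y j"
      using k cells_bounds[OF k(1)] j by (auto simp: st mem_ocell y_less_iff)
    then have pos: "0 < \<bar>t' - y j\<bar>" by simp
    obtain N where "\<epsilon> / \<bar>t' - y j\<bar> < real N"
      using reals_Archimedean2 by blast
    then have N: "\<epsilon> < real N * \<bar>t' - y j\<bar>" using pos by (simp add: pos_divide_less_eq)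
    have "\<phi> n z = 0" if "n \<ge> N" for n
    proof -
      have "real N * \<bar>t' - y j\<bar> \<le> real (Suc n) * \<bar>t' - y j\<bar>"
        using that by (intro mult_right_mono) auto
      with N have "\<epsilon> < \<bar>t' - y j\<bar> * real (Suc n)" by (simp add: mult.commute)
      then have "1 / q n < \<bar>t' - y j\<bar>" by (simp add: q_def pos_divide_less_eq)
      then show ?thesis unfolding \<phi>_def st by (intro bump_eq_0 q) auto
    qed
    then show ?thesis by (auto intro!: tendsto_eventually eventually_sequentiallyI)
  qed
  ultimately have "(t (i, j) - b (i, j + 1)) * C = 0"
    using bump_bounds by (intro bdry_vanishing_limit[OF \<tau> d test]) (auto simp: \<phi>_def)
  moreover have "C \<noteq> 0"
  proof
    assume "C = 0"
    have "(\<theta>, y j) \<in> {x (i - 1)<..<x i} \<times> {y (j - 1)<..<y (j + 1)}"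
      using \<epsilon> by (intro subsetD[OF sub(2)]) (simp add: cbox_Pair_real)
    then have \<theta>: "\<theta> \<in> {x (i - 1)..x i}" by simp
    have "continuous_on {x (i - 1)..x i} (\<lambda>s. \<phi> 0 (s, y j))"
      by (intro continuous_on_compose2[OF cont] continuous_intros) auto
    then have "\<phi> 0 (\<theta>, y j) = 0"
      using \<open>C = 0\<close> \<theta> integral_eq_0_iff[of "x (i - 1)" "x i" "\<lambda>s. \<phi> 0 (s, y j)"] cells_less(1)[OF cells(1)]
      by (auto simp: C_def \<phi>_def bump_bounds)
    moreover have "\<phi> 0 (\<theta>, y j) > 0"
      unfolding \<phi>_def using q[of 0] \<epsilon> by (intro bump_pos) auto
    ultimately show False by simp
  qed
  ultimately show ?thesis by simp
qed

section \<open>Jump conditions\<close>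

abbreviation seg_right :: "nat \<times> nat \<Rightarrow> edge" where
  "seg_right k \<equiv> ((x (fst k), y (snd k - 1)), (x (fst k), y (snd k)))"

abbreviation seg_left :: "nat \<times> nat \<Rightarrow> edge" where
  "seg_left k \<equiv> ((x (fst k - 1), y (snd k - 1)), (x (fst k - 1), y (snd k)))"

abbreviation seg_top :: "nat \<times> nat \<Rightarrow> edge" where
  "seg_top k \<equiv> ((x (fst k - 1), y (snd k)), (x (fst k), y (snd k)))"

abbreviation seg_bottom :: "nat \<times> nat \<Rightarrow> edge" where
  "seg_bottom k \<equiv> ((x (fst k - 1), y (snd k - 1)), (x (fst k), y (snd k - 1)))"

abbreviation on_frontier :: "edge \<Rightarrow> bool" where
  "on_frontier e \<equiv> closed_segment (fst e) (snd e) \<subseteq> frontier \<Omega>"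

text \<open>\<open>cell_edges\<close> ranges over all ways to write the set as a product of
  intervals; for a nondegenerate rectangle there is only one.\<close>

lemma cell_edges_cell:
  assumes "k \<in> cells"
  shows "cell_edges (cell k) = {seg_bottom k, seg_top k, seg_left k, seg_right k}"
proof -
  have "(cell k = {a..b} \<times> {c..d}) \<longleftrightarrow>
      a = x (fst k - 1) \<and> b = x (fst k) \<and> c = y (snd k - 1) \<and> d = y (snd k)" if "a < b" "c < d" for a b c d
  proof -
    have "cell k = {a..b} \<times> {c..d} \<longleftrightarrow>
        {x (fst k - 1)..x (fst k)} = {a..b} \<and> {y (snd k - 1)..y (snd k)} = {c..d}"
      using cells_less[OF assms] that by (simp add: cell_eq times_eq_iff)
    then show ?thesis using cells_less[OF assms] that by (auto simp: Icc_eq_Icc)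
  qed
  then have "(a < b \<and> c < d \<and> cell k = {a..b} \<times> {c..d} \<and> P) \<longleftrightarrow>
      a = x (fst k - 1) \<and> b = x (fst k) \<and> c = y (snd k - 1) \<and> d = y (snd k) \<and> P" for a b c d P
    using cells_less[OF assms] by blast
  then show ?thesis unfolding cell_edges_def by (simp only:) blast
qed

lemma segment_subset_cell:
  assumes "k \<in> cells" "e \<in> cell_edges (cell k)"
  shows "closed_segment (fst e) (snd e) \<subseteq> cell k"
proof (rule closed_segment_subset)
  show "fst e \<in> cell k" "snd e \<in> cell k"
    using assms cells_less[OF assms(1)] by (auto simp: cell_edges_cell mem_cell)
  show "convex (cell k)" by (simp add: cell_def convex_box)
qed

lemma edge_integral_sides:
  assumes "k \<in> cells" "continuous_on UNIV v"
  shows "edge_right v k = edge_integral (seg_right k) v" "edge_left v k = edge_integral (seg_left k) v"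
    "edge_top v k = edge_integral (seg_top k) v" "edge_bottom v k = edge_integral (seg_bottom k) v"
  using cells_less[OF assms(1)] assms(2)
  by (simp_all add: edge_defs edge_integral_vertical edge_integral_horizontal)

text \<open>The limit in \<open>cell_trace\<close> is unique because every point of the closed cell
  is a limit point of the open one, and the continuous p supplies its value.\<close>

lemma cell_trace_eq:
  assumes k: "k \<in> cells" and z: "z \<in> cell k"
    and v: "\<And>z. z \<in> ocell k \<Longrightarrow> v z = p z" and p: "continuous_on UNIV p"
  shows "cell_trace (cell k) v z = p z"
  unfolding cell_trace_def interior_cell
proof (rule tendsto_Lim)
  have ne: "ocell k \<noteq> {}"
  proof -
    have "((x (fst k - 1) + x (fst k)) / 2, (y (snd k - 1) + y (snd k)) / 2) \<in> ocell k"
      using cells_less[OF k] by (simp add: mem_ocell)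
    then show ?thesis by blast
  qed
  have "z \<in> closure (ocell k)"
    using z ne unfolding ocell_def cell_def by (simp add: closure_box)
  then have "z islimpt ocell k"
    using interior_limit_point[of z "ocell k"] interior_open[OF open_box] by (auto simp: closure_def ocell_def)
  then show "\<not> trivial_limit (at z within ocell k)" by (simp add: trivial_limit_within)
  have "(p \<longlongrightarrow> p z) (at z within ocell k)"
    using p by (meson UNIV_I continuous_on_def tendsto_within_subset top_greatest)
  then show "(v \<longlongrightarrow> p z) (at z within ocell k)"
    by (rule Lim_transform_eventually) (auto simp: eventually_at_filter v)
qed

text \<open>Functions in the \<open>EQ\<close> space are handled through their polynomials \<open>v k\<close> on the cells \<open>k\<close>.\<close>

definition conforming :: "(nat \<times> nat \<Rightarrow> point \<Rightarrow> real) \<Rightarrow> bool" where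
  "conforming v \<longleftrightarrow>
     (\<forall>k\<in>cells. \<forall>e\<in>cell_edges (cell k). on_frontier e \<longrightarrow> edge_integral e (v k) = 0) \<and>
     (\<forall>k\<in>cells. \<forall>m\<in>cells. \<forall>e\<in>cell_edges (cell k) \<inter> cell_edges (cell m).
        \<not> on_frontier e \<longrightarrow> edge_integral e (v k) = edge_integral e (v m))"

lemma conformingD:
  assumes "conforming v"
  shows "k \<in> cells \<Longrightarrow> e \<in> cell_edges (cell k) \<Longrightarrow> on_frontier e \<Longrightarrow> edge_integral e (v k) = 0"
    and "k \<in> cells \<Longrightarrow> m \<in> cells \<Longrightarrow> e \<in> cell_edges (cell k) \<Longrightarrow> e \<in> cell_edges (cell m) \<Longrightarrow> \<not> on_frontier e \<Longrightarrow>
      edge_integral e (v k) = edge_integral e (v m)"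
proof -
  show "edge_integral e (v k) = 0" if "k \<in> cells" "e \<in> cell_edges (cell k)" "on_frontier e"
    using conjunct1[OF assms[unfolded conforming_def]] that by blast
  show "edge_integral e (v k) = edge_integral e (v m)"
    if "k \<in> cells" "m \<in> cells" "e \<in> cell_edges (cell k)" "e \<in> cell_edges (cell m)" "\<not> on_frontier e"
    using bspec[OF bspec[OF bspec[OF conjunct2[OF assms[unfolded conforming_def]] that(1)] that(2)] IntI[OF that(3,4)]]
      that(5) by (rule mp)
qed

lemma conforming_diff:
  assumes "conforming v" "conforming w"
    and "\<And>k. k \<in> cells \<Longrightarrow> continuous_on UNIV (v k)" "\<And>k. k \<in> cells \<Longrightarrow> continuous_on UNIV (w k)"
  shows "conforming (\<lambda>k z. v k z - w k z)"
  unfolding conforming_def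
proof (intro conjI ballI impI)
  fix k e assume "k \<in> cells" "e \<in> cell_edges (cell k)" "on_frontier e"
  then show "edge_integral e (\<lambda>z. v k z - w k z) = 0"
    by (simp add: edge_integral_diff assms conformingD(1)[OF assms(1)] conformingD(1)[OF assms(2)])
next
  fix k m e assume "k \<in> cells" "m \<in> cells" "e \<in> cell_edges (cell k) \<inter> cell_edges (cell m)" "\<not> on_frontier e"
  then have "edge_integral e (v k) = edge_integral e (v m)" "edge_integral e (w k) = edge_integral e (w m)"
    using conformingD(2)[OF assms(1), of k m e] conformingD(2)[OF assms(2), of k m e] by simp_all
  then show "edge_integral e (\<lambda>z. v k z - w k z) = edge_integral e (\<lambda>z. v m z - w m z)"
    using \<open>k \<in> cells\<close> \<open>m \<in> cells\<close> by (simp add: edge_integral_diff assms(3,4))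
qed

text \<open>On the closed edges the traces are the values of the continuous extensions
  \<open>V k\<close>, so jumps become differences of these.\<close>

lemma conforming_iff_jumps:
  assumes v: "\<And>k z. k \<in> cells \<Longrightarrow> z \<in> ocell k \<Longrightarrow> v z = V k z"
    and V: "\<And>k. k \<in> cells \<Longrightarrow> continuous_on UNIV (V k)"
  shows "(\<forall>e\<in>mesh_edges T. \<forall>g\<in>jumps \<Omega> T v e. edge_integral e g = 0) \<longleftrightarrow> conforming V"
proof -
  have trace: "cell_trace (cell k) v z = V k z" if "k \<in> cells" "z \<in> cell k" for k z
    using that v V by (intro cell_trace_eq)
  have single: "edge_integral e (cell_trace (cell k) v) = edge_integral e (V k)"
    if "k \<in> cells" "e \<in> cell_edges (cell k)" for k e
    using segment_subset_cell[OF that] that by (intro edge_integral_cong trace) auto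
  have double: "edge_integral e (\<lambda>z. cell_trace (cell k) v z - cell_trace (cell m) v z) =
      edge_integral e (V k) - edge_integral e (V m)"
    if "k \<in> cells" "m \<in> cells" "e \<in> cell_edges (cell k)" "e \<in> cell_edges (cell m)" for k m e
  proof -
    have "edge_integral e (\<lambda>z. cell_trace (cell k) v z - cell_trace (cell m) v z) = edge_integral e (\<lambda>z. V k z - V m z)"
      using segment_subset_cell[OF that(1,3)] segment_subset_cell[OF that(2,4)] that
      by (intro edge_integral_cong) (auto simp: trace subset_eq)
    then show ?thesis by (simp add: edge_integral_diff V that)
  qed
  show ?thesis
  proof
    assume *: "\<forall>e\<in>mesh_edges T. \<forall>g\<in>jumps \<Omega> T v e. edge_integral e g = 0"
    show "conforming V"
      unfolding conforming_def
    proof (intro conjI ballI impI)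
      fix k e assume k: "k \<in> cells" "e \<in> cell_edges (cell k)" "on_frontier e"
      then have "cell_trace (cell k) v \<in> jumps \<Omega> T v e" "e \<in> mesh_edges T"
        by (auto simp: jumps_def mesh_edges_def T_eq)
      with * k show "edge_integral e (V k) = 0" using single by metis
    next
      fix k m e assume k: "k \<in> cells" "m \<in> cells" "e \<in> cell_edges (cell k) \<inter> cell_edges (cell m)" "\<not> on_frontier e"
      show "edge_integral e (V k) = edge_integral e (V m)"
      proof (cases "cell k = cell m")
        case True
        have "((x (fst k - 1) + x (fst k)) / 2, (y (snd k - 1) + y (snd k)) / 2) \<in> ocell k"
          using cells_less[OF k(1)] by (simp add: mem_ocell)
        \<comment> \<open>\<open>jumps\<close> tells cells apart as sets, \<open>conforming\<close>
          by their indices; equal sets share an inner point, and this forces equal indices.\<close>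
        then have "k = m" using True k ocell_subset_cell ocell_inj by blast
        then show ?thesis by simp
      next
        case False
        with k have "(\<lambda>z. cell_trace (cell k) v z - cell_trace (cell m) v z) \<in> jumps \<Omega> T v e" "e \<in> mesh_edges T"
          by (auto simp: jumps_def mesh_edges_def T_eq)
        with * k show ?thesis using double[of k m e] by auto
      qed
    qed
  next
    assume V: "conforming V"
    show "\<forall>e\<in>mesh_edges T. \<forall>g\<in>jumps \<Omega> T v e. edge_integral e g = 0"
    proof (intro ballI)
      fix e g assume g: "g \<in> jumps \<Omega> T v e"
      show "edge_integral e g = 0"
      proof (cases "on_frontier e")
        case True
        then obtain k where "k \<in> cells" "e \<in> cell_edges (cell k)" "g = cell_trace (cell k) v"
          using g by (auto simp: jumps_def T_eq)
        then show ?thesis using single conformingD(1)[OF V] True by simp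
      next
        case False
        then obtain k m where km: "k \<in> cells" "m \<in> cells" "e \<in> cell_edges (cell k)" "e \<in> cell_edges (cell m)"
          "g = (\<lambda>z. cell_trace (cell k) v z - cell_trace (cell m) v z)"
          using g by (auto simp: jumps_def T_eq)
        then show ?thesis using double[OF km(1-4)] conformingD(2)[OF V km(1-4) False] by simp
      qed
    qed
  qed
qed

text \<open>The edge lies in the closure of the open domain, so any of its points off the frontier
  is in the domain. The edge may still lie partly on the frontier.\<close>

lemma on_frontier_or_meets:
  assumes "k \<in> cells" "e \<in> cell_edges (cell k)" "\<not> on_frontier e"
  obtains z where "z \<in> closed_segment (fst e) (snd e)" "z \<in> \<Omega>"
proof -
  obtain z where z: "z \<in> closed_segment (fst e) (snd e)" "z \<notin> frontier \<Omega>" using assms(3) by blast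
  then have "z \<in> closure \<Omega>"
    using segment_subset_cell[OF assms(1,2)] assms(1) by (auto simp: cells_def)
  with z that show thesis using open_domain by (auto simp: frontier_def interior_open)
qed

lemma vertical_neighbours:
  assumes k: "k \<in> cells" and e: "e \<in> cell_edges (cell k)" "\<not> on_frontier e"
    and ij: "e = ((x i, y (j - 1)), (x i, y j))" "i \<le> n\<^sub>1" "1 \<le> j" "j \<le> n\<^sub>2"
  obtains t where "(i, j) \<in> cells" "(i + 1, j) \<in> cells" "(x i, t) \<in> \<Omega>" "y (j - 1) \<le> t" "t \<le> y j"
proof -
  obtain z where z: "z \<in> closed_segment (fst e) (snd e)" "z \<in> \<Omega>" by (rule on_frontier_or_meets[OF k e])
  have "y (j - 1) < y j" using ij by (simp add: y_less_iff)
  then have "closed_segment (fst e) (snd e) \<subseteq> {x i..x i} \<times> {y (j - 1)..y j}"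
    unfolding ij(1) by (intro closed_segment_subset) (auto intro: convex_Times)
  with z obtain t where t: "(x i, t) \<in> \<Omega>" "y (j - 1) \<le> t" "t \<le> y j" by (cases z) auto
  with vertical_edge_neighbourhood[OF ij(2-4) t] that show thesis by blast
qed

lemma horizontal_neighbours:
  assumes k: "k \<in> cells" and e: "e \<in> cell_edges (cell k)" "\<not> on_frontier e"
    and ij: "e = ((x (i - 1), y j), (x i, y j))" "j \<le> n\<^sub>2" "1 \<le> i" "i \<le> n\<^sub>1"
  obtains s where "(i, j) \<in> cells" "(i, j + 1) \<in> cells" "(s, y j) \<in> \<Omega>" "x (i - 1) \<le> s" "s \<le> x i"
proof -
  obtain z where z: "z \<in> closed_segment (fst e) (snd e)" "z \<in> \<Omega>" by (rule on_frontier_or_meets[OF k e])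
  have "x (i - 1) < x i" using ij by (simp add: x_less_iff)
  then have "closed_segment (fst e) (snd e) \<subseteq> {x (i - 1)..x i} \<times> {y j..y j}"
    unfolding ij(1) by (intro closed_segment_subset) (auto intro: convex_Times)
  with z obtain s where s: "(s, y j) \<in> \<Omega>" "x (i - 1) \<le> s" "s \<le> x i" by (cases z) auto
  with horizontal_edge_neighbourhood[OF ij(2-4) s] that show thesis by blast
qed

text \<open>Regroup the boundary sum by edges: those on the frontier drop out because v has mean
  zero there; on every other edge normal component and edge integral agree from both sides, while
  the outward normals are opposite.\<close>

lemma bdry_conforming:
  assumes \<tau>: "\<And>k z. k \<in> cells \<Longrightarrow> z \<in> ocell k \<Longrightarrow> \<tau> z = rt l r b t k z"
    and d: "has_weak_div \<Omega> \<tau> d"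
    and v: "conforming v" and cont: "\<And>k. k \<in> cells \<Longrightarrow> continuous_on UNIV (v k)"
  shows "bdry l r b t v = 0"
proof -
  note sides = edge_integral_sides[OF _ cont]
  have "(\<Sum>k\<in>cells. r k * edge_right (v k) k) = (\<Sum>k\<in>{k\<in>cells. \<not> on_frontier (seg_right k)}. r k * edge_right (v k) k)"
    using finite_cells conformingD(1)[OF v]
    by (intro sum.mono_neutral_right) (auto simp: sides cell_edges_cell)
  also have "\<dots> = (\<Sum>k\<in>{k\<in>cells. \<not> on_frontier (seg_left k)}. l k * edge_left (v k) k)"
  \<comment> \<open>The right side of a cell is the left side of its right neighbour. The truncated
    subtraction in the inverse shift is harmless, since the indices of cells start at 1.\<close>
  proof (rule sum.reindex_bij_witness[where i="\<lambda>k. (fst k - 1, snd k)" and j="\<lambda>k. (fst k + 1, snd k)"])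
    fix k assume "k \<in> {k \<in> cells. \<not> on_frontier (seg_right k)}"
    then have k: "k \<in> cells" "\<not> on_frontier (seg_right k)" by auto
    note bd = cells_bounds[OF k(1)]
    have e: "seg_right k \<in> cell_edges (cell k)" by (simp add: cell_edges_cell[OF k(1)])
    obtain t\<^sub>0 where nb: "(fst k + 1, snd k) \<in> cells"
      and t\<^sub>0: "(x (fst k), t\<^sub>0) \<in> \<Omega>" "y (snd k - 1) \<le> t\<^sub>0" "t\<^sub>0 \<le> y (snd k)"
      using vertical_neighbours[OF k(1) e k(2) refl bd(2-4)] by metis
    show "(fst k + 1, snd k) \<in> {k \<in> cells. \<not> on_frontier (seg_left k)}" using nb k by simp
    show "(fst (fst k + 1, snd k) - 1, snd (fst k + 1, snd k)) = k" by simp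
    have "seg_right k \<in> cell_edges (cell (fst k + 1, snd k))" using cell_edges_cell[OF nb] by simp
    then have "edge_integral (seg_right k) (v k) = edge_integral (seg_right k) (v (fst k + 1, snd k))"
      using conformingD(2)[OF v k(1) nb e] k(2) by simp
    moreover have "r k = l (fst k + 1, snd k)"
      using normal_continuity_vertical[of \<tau> l r b t d, OF \<tau> d bd(2-4) t\<^sub>0] by simp
    ultimately show "l (fst k + 1, snd k) * edge_left (v (fst k + 1, snd k)) (fst k + 1, snd k) = r k * edge_right (v k) k"
      using sides(2)[OF nb nb] sides(1)[OF k(1) k(1)] by simp
  next
    fix k assume "k \<in> {k \<in> cells. \<not> on_frontier (seg_left k)}"
    then have k: "k \<in> cells" "\<not> on_frontier (seg_left k)" by auto
    note bd = cells_bounds[OF k(1)]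
    have e: "seg_left k \<in> cell_edges (cell k)" by (simp add: cell_edges_cell[OF k(1)])
    have "fst k - 1 \<le> n\<^sub>1" using bd by simp
    then have "(fst k - 1, snd k) \<in> cells"
      using vertical_neighbours[OF k(1) e k(2) refl _ bd(3-4)] by metis
    then show "(fst k - 1, snd k) \<in> {k \<in> cells. \<not> on_frontier (seg_right k)}" using k by simp
    show "(fst (fst k - 1, snd k) + 1, snd (fst k - 1, snd k)) = k" using bd by (simp add: prod_eq_iff)
  qed
  also have "\<dots> = (\<Sum>k\<in>cells. l k * edge_left (v k) k)"
    using finite_cells conformingD(1)[OF v]
    by (intro sum.mono_neutral_left) (auto simp: sides cell_edges_cell)
  finally have x: "(\<Sum>k\<in>cells. r k * edge_right (v k) k) = (\<Sum>k\<in>cells. l k * edge_left (v k) k)" .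
  have "(\<Sum>k\<in>cells. t k * edge_top (v k) k) = (\<Sum>k\<in>{k\<in>cells. \<not> on_frontier (seg_top k)}. t k * edge_top (v k) k)"
    using finite_cells conformingD(1)[OF v]
    by (intro sum.mono_neutral_right) (auto simp: sides cell_edges_cell)
  also have "\<dots> = (\<Sum>k\<in>{k\<in>cells. \<not> on_frontier (seg_bottom k)}. b k * edge_bottom (v k) k)"
  proof (rule sum.reindex_bij_witness[where i="\<lambda>k. (fst k, snd k - 1)" and j="\<lambda>k. (fst k, snd k + 1)"])
    fix k assume "k \<in> {k \<in> cells. \<not> on_frontier (seg_top k)}"
    then have k: "k \<in> cells" "\<not> on_frontier (seg_top k)" by auto
    note bd = cells_bounds[OF k(1)]
    have e: "seg_top k \<in> cell_edges (cell k)" by (simp add: cell_edges_cell[OF k(1)])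
    obtain s\<^sub>0 where nb: "(fst k, snd k + 1) \<in> cells"
      and s\<^sub>0: "(s\<^sub>0, y (snd k)) \<in> \<Omega>" "x (fst k - 1) \<le> s\<^sub>0" "s\<^sub>0 \<le> x (fst k)"
      using horizontal_neighbours[OF k(1) e k(2) refl bd(4,1,2)] by metis
    show "(fst k, snd k + 1) \<in> {k \<in> cells. \<not> on_frontier (seg_bottom k)}" using nb k by simp
    show "(fst (fst k, snd k + 1), snd (fst k, snd k + 1) - 1) = k" by simp
    have "seg_top k \<in> cell_edges (cell (fst k, snd k + 1))" using cell_edges_cell[OF nb] by simp
    then have "edge_integral (seg_top k) (v k) = edge_integral (seg_top k) (v (fst k, snd k + 1))"
      using conformingD(2)[OF v k(1) nb e] k(2) by simp
    moreover have "t k = b (fst k, snd k + 1)"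
      using normal_continuity_horizontal[of \<tau> l r b t d, OF \<tau> d bd(4,1,2) s\<^sub>0] by simp
    ultimately show "b (fst k, snd k + 1) * edge_bottom (v (fst k, snd k + 1)) (fst k, snd k + 1) = t k * edge_top (v k) k"
      using sides(4)[OF nb nb] sides(3)[OF k(1) k(1)] by simp
  next
    fix k assume "k \<in> {k \<in> cells. \<not> on_frontier (seg_bottom k)}"
    then have k: "k \<in> cells" "\<not> on_frontier (seg_bottom k)" by auto
    note bd = cells_bounds[OF k(1)]
    have e: "seg_bottom k \<in> cell_edges (cell k)" by (simp add: cell_edges_cell[OF k(1)])
    have "snd k - 1 \<le> n\<^sub>2" using bd by simp
    then have "(fst k, snd k - 1) \<in> cells"
      using horizontal_neighbours[OF k(1) e k(2) refl _ bd(1,2)] by metis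
    then show "(fst k, snd k - 1) \<in> {k \<in> cells. \<not> on_frontier (seg_top k)}" using k by simp
    show "(fst (fst k, snd k - 1), snd (fst k, snd k - 1) + 1) = k" using bd by (simp add: prod_eq_iff)
  qed
  also have "\<dots> = (\<Sum>k\<in>cells. b k * edge_bottom (v k) k)"
    using finite_cells conformingD(1)[OF v]
    by (intro sum.mono_neutral_left) (auto simp: sides cell_edges_cell)
  finally have "(\<Sum>k\<in>cells. t k * edge_top (v k) k) = (\<Sum>k\<in>cells. b k * edge_bottom (v k) k)" .
  with x show ?thesis by (simp add: bdry_def sum.distrib sum_subtractf)
qed

section \<open>Edge fields, projections and potentials\<close>

lemma measure_cell:
  assumes "k \<in> cells"
  shows "measure lborel (cell k) \<noteq> 0"
  using cells_less[OF assms] by (simp add: cell_def content_Pair)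

text \<open>If the boundary sum vanishes on test functions, Green's formula says that the
  elementwise divergence is a weak divergence. This criterion spares a comparison of normal
  components edge by edge.\<close>

lemma cellwise_rt_RT_space:
  assumes "\<And>\<phi>. \<phi> \<in> test_functions \<Omega> \<Longrightarrow> bdry l r b t (\<lambda>k. \<phi>) = 0"
  shows "cellwise (rt l r b t) \<in> RT_space \<Omega> T"
proof -
  let ?\<tau> = "cellwise (rt l r b t)" and ?D = "cellwise (\<lambda>k z. rt_div l r b t k)"
  have L2: "?\<tau> \<in> L2_space \<Omega>" "?D \<in> L2_space \<Omega>"
    by (intro cellwise_L2 continuous_on_rt, intro cellwise_L2 continuous_on_const)
  have "L2_inner \<Omega> ?\<tau> (grad \<phi>) = - L2_inner \<Omega> ?D \<phi>" if \<phi>: "\<phi> \<in> test_functions \<Omega>" for \<phi>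
  proof -
    note C = test_functionD(1)[OF \<phi>]
    have "L2_inner \<Omega> ?\<tau> (grad \<phi>) = (\<Sum>k\<in>cells. integral (cell k) (\<lambda>z. rt l r b t k z \<bullet> grad \<phi> z))"
      by (rule L2_inner_cells) (simp_all add: cellwise_eq continuous_on_rt C_k_Suc_continuous(4)[OF C])
    moreover have "L2_inner \<Omega> ?D \<phi> = (\<Sum>k\<in>cells. integral (cell k) (\<lambda>z. rt_div l r b t k \<bullet> \<phi> z))"
      by (rule L2_inner_cells) (simp_all add: cellwise_eq C_k_Suc_continuous(1)[OF C])
    ultimately show ?thesis
      using green[of "\<lambda>k. \<phi>" l r b t] C assms[OF \<phi>] by simp
  qed
  then have "has_weak_div \<Omega> ?\<tau> ?D" using L2 by (simp add: has_weak_div_def)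
  then have "?\<tau> \<in> H_div \<Omega>" using L2 by (auto simp: H_div_def)
  moreover have "\<exists>p\<in>Q_poly 1 0. \<exists>q\<in>Q_poly 0 1. \<forall>z\<in>ocell k. ?\<tau> z = (p z, q z)" if "k \<in> cells" for k
  proof (intro bexI ballI)
    show "?\<tau> z = (ramp (x (fst k - 1)) (x (fst k)) (l k) (r k) (fst z), ramp (y (snd k - 1)) (y (snd k)) (b k) (t k) (snd z))"
      if "z \<in> ocell k" for z
      by (simp add: cellwise_eq[OF \<open>k \<in> cells\<close> that] rt_def)
    have ramp_affine: "ramp a a' u u' s = (u - (u' - u) / (a' - a) * a) + (u' - u) / (a' - a) * s" for a a' u u' s
      by (simp add: ramp_def right_diff_distrib)
    show "(\<lambda>z. ramp (x (fst k - 1)) (x (fst k)) (l k) (r k) (fst z)) \<in> Q_poly 1 0"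
      unfolding Q_poly_def ramp_affine
      by (intro CollectI exI[of _ "\<lambda>i j. if i = 0 then l k - (r k - l k) / (x (fst k) - x (fst k - 1)) * x (fst k - 1)
        else (r k - l k) / (x (fst k) - x (fst k - 1))"]) simp
    show "(\<lambda>z. ramp (y (snd k - 1)) (y (snd k)) (b k) (t k) (snd z)) \<in> Q_poly 0 1"
      unfolding Q_poly_def ramp_affine
      by (intro CollectI exI[of _ "\<lambda>i j. if j = 0 then b k - (t k - b k) / (y (snd k) - y (snd k - 1)) * y (snd k - 1)
        else (t k - b k) / (y (snd k) - y (snd k - 1))"]) simp
  qed
  ultimately show ?thesis by (simp add: RT_space_def T_eq interior_cell)
qed

text \<open>The sign of the normal of the edge \<open>e\<close> of cell \<open>k\<close>, oriented to the right or upwards,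
  relative to the outer normal of the cell.\<close>

definition orientation :: "edge \<Rightarrow> nat \<times> nat \<Rightarrow> real" where
  "orientation e k = (if e = seg_right k \<or> e = seg_top k then 1 else - 1)"

text \<open>The four families describe the field that in the cells of S has normal component 1 on e
  and 0 on the other edges, and that is zero elsewhere. S will be one cell at a frontier edge, or
  the two cells sharing e.\<close>

lemma bdry_edge_field:
  assumes S: "S \<subseteq> cells" and e: "\<And>k. k \<in> S \<Longrightarrow> e \<in> cell_edges (cell k)"
    and v: "\<And>k. k \<in> cells \<Longrightarrow> continuous_on UNIV (v k)"
  shows "bdry (\<lambda>k. of_bool (k \<in> S \<and> seg_left k = e)) (\<lambda>k. of_bool (k \<in> S \<and> seg_right k = e))
      (\<lambda>k. of_bool (k \<in> S \<and> seg_bottom k = e)) (\<lambda>k. of_bool (k \<in> S \<and> seg_top k = e)) v =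
    (\<Sum>k\<in>S. orientation e k * edge_integral e (v k))"
proof -
  have "of_bool (k \<in> S \<and> seg_right k = e) * edge_right (v k) k - of_bool (k \<in> S \<and> seg_left k = e) * edge_left (v k) k +
      (of_bool (k \<in> S \<and> seg_top k = e) * edge_top (v k) k - of_bool (k \<in> S \<and> seg_bottom k = e) * edge_bottom (v k) k) =
      (if k \<in> S then orientation e k * edge_integral e (v k) else 0)" if k: "k \<in> cells" for k
  proof (cases "k \<in> S")
    case True
    have "e \<in> {seg_bottom k, seg_top k, seg_left k, seg_right k}"
      using e[OF True] by (simp only: cell_edges_cell[OF k])
    then consider "e = seg_bottom k" | "e = seg_top k" | "e = seg_left k" | "e = seg_right k" by blast
    then show ?thesis
      using True cells_less[OF k] edge_integral_sides[OF k v[OF k]] by cases (auto simp: orientation_def)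
  qed simp
  then have "bdry (\<lambda>k. of_bool (k \<in> S \<and> seg_left k = e)) (\<lambda>k. of_bool (k \<in> S \<and> seg_right k = e))
      (\<lambda>k. of_bool (k \<in> S \<and> seg_bottom k = e)) (\<lambda>k. of_bool (k \<in> S \<and> seg_top k = e)) v =
    (\<Sum>k\<in>cells. if k \<in> S then orientation e k * edge_integral e (v k) else 0)"
    unfolding bdry_def by (intro sum.cong) simp_all
  also have "\<dots> = (\<Sum>k\<in>cells \<inter> S. orientation e k * edge_integral e (v k))"
    by (rule sum.inter_restrict[OF finite_cells, symmetric])
  also have "cells \<inter> S = S" using S by blast
  finally show ?thesis .
qed

text \<open>If e were the same side of both cells, their indices would agree; and a vertical side is
  never a horizontal one, as sides are nondegenerate. So e is right or top for one cell and left or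
  bottom for the other.\<close>

lemma orientation_opposite:
  assumes k: "k \<in> cells" "m \<in> cells" "k \<noteq> m" and e: "e \<in> cell_edges (cell k)" "e \<in> cell_edges (cell m)"
  shows "orientation e m = - orientation e k"
proof -
  note bd = cells_bounds[OF k(1)] cells_bounds[OF k(2)]
  have less: "x (fst k - 1) \<noteq> x (fst k)" "y (snd k - 1) \<noteq> y (snd k)" "x (fst m - 1) \<noteq> x (fst m)" "y (snd m - 1) \<noteq> y (snd m)"
    using cells_less[OF k(1)] cells_less[OF k(2)] by auto
  have eqs: "x (fst k) = x (fst m) \<Longrightarrow> fst k = fst m" "y (snd k) = y (snd m) \<Longrightarrow> snd k = snd m"
    using bd by (simp_all add: x_eq_iff y_eq_iff)
  have "fst k - 1 \<le> n\<^sub>1" "fst m - 1 \<le> n\<^sub>1" "snd k - 1 \<le> n\<^sub>2" "snd m - 1 \<le> n\<^sub>2"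
    using bd by simp_all
  then have "x (fst k - 1) = x (fst m - 1) \<Longrightarrow> fst k - 1 = fst m - 1"
    "y (snd k - 1) = y (snd m - 1) \<Longrightarrow> snd k - 1 = snd m - 1"
    by (simp_all only: x_eq_iff y_eq_iff)
  then have eqs': "x (fst k - 1) = x (fst m - 1) \<Longrightarrow> fst k = fst m" "y (snd k - 1) = y (snd m - 1) \<Longrightarrow> snd k = snd m"
    using bd by linarith+
  have ne: "\<not> (fst k = fst m \<and> snd k = snd m)" using k(3) by (simp add: prod_eq_iff)
  have "e \<in> {seg_bottom k, seg_top k, seg_left k, seg_right k}" "e \<in> {seg_bottom m, seg_top m, seg_left m, seg_right m}"
    using e by (simp_all only: cell_edges_cell[OF k(1)] cell_edges_cell[OF k(2)])
  then have "(e = seg_right k \<or> e = seg_top k) \<longleftrightarrow> \<not> (e = seg_right m \<or> e = seg_top m)"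
    using less eqs eqs' ne unfolding insert_iff empty_iff
    by (elim disjE) (simp_all only: prod.inject, metis+)
  then show ?thesis by (simp add: orientation_def)
qed

text \<open>The premise \<open>orth\<close> is the abstract form of the first RT equation.
  Single-edge fields qualify for it: at a frontier edge because test functions vanish there, at a
  shared edge because the two orientations cancel for a single-valued function.\<close>

lemma conformingI:
  assumes v: "\<And>k. k \<in> cells \<Longrightarrow> continuous_on UNIV (v k)"
    and orth: "\<And>l r b t. (\<And>\<phi>. \<phi> \<in> test_functions \<Omega> \<Longrightarrow> bdry l r b t (\<lambda>k. \<phi>) = 0) \<Longrightarrow> bdry l r b t v = 0"
  shows "conforming v"
  unfolding conforming_def
proof (intro conjI ballI impI)
  note test = C_k_continuous[OF test_functionD(1)[where k=0]]
  fix k e assume k: "k \<in> cells" and e: "e \<in> cell_edges (cell k)" "on_frontier e"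
  have "edge_integral e \<phi> = 0" if "\<phi> \<in> test_functions \<Omega>" for \<phi>
  proof -
    have "edge_integral e \<phi> = edge_integral e (\<lambda>z. 0)"
      using e(2) open_domain
      by (intro edge_integral_cong test_functionD(2)[OF that]) (auto simp: frontier_def interior_open)
    then show ?thesis by (simp add: edge_integral_const)
  qed
  \<comment> \<open>\<open>bdry_edge_field\<close> is read twice: backwards for v, then forwards for
    the test functions that \<open>orth\<close> asks about.\<close>
  then have "(\<Sum>m\<in>{k}. orientation e m * edge_integral e (v m)) = 0"
    using k e by (subst bdry_edge_field[symmetric], (auto simp: v)[3], intro orth, subst bdry_edge_field)
      (auto simp: test)
  then show "edge_integral e (v k) = 0" by (auto simp: orientation_def split: if_splits)
next
  note test = C_k_continuous[OF test_functionD(1)[where k=0]]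
  fix k m e assume k: "k \<in> cells" "m \<in> cells" and e: "e \<in> cell_edges (cell k) \<inter> cell_edges (cell m)" "\<not> on_frontier e"
  show "edge_integral e (v k) = edge_integral e (v m)"
  proof (cases "k = m")
    case False
    have op: "orientation e m = - orientation e k"
      using orientation_opposite[OF k False] e by simp
    have "(\<Sum>i\<in>{k, m}. orientation e i * edge_integral e (v i)) = 0"
      using k e by (subst bdry_edge_field[symmetric], (auto simp: v)[3], intro orth, subst bdry_edge_field)
        (auto simp: test False op)
    then have "orientation e k * (edge_integral e (v k) - edge_integral e (v m)) = 0"
      using False op by (simp add: algebra_simps)
    then show ?thesis by (auto simp: orientation_def split: if_splits)
  qed simp
qed

text \<open>w witnesses that the choice in \<open>L2_projection\<close> succeeds; two projections of
  g differ by a piecewise constant that is orthogonal to itself.\<close>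

lemma proj0_AE:
  assumes g: "g \<in> L2_space \<Omega>" and w: "w \<in> P0_space \<Omega> T"
    and orth: "\<And>v. v \<in> P0_space \<Omega> T \<Longrightarrow> L2_inner \<Omega> (\<lambda>z. g z - w z) v = 0"
  shows "proj0 \<Omega> T g \<in> P0_space \<Omega> T" "AE z in lebesgue_on \<Omega>. proj0 \<Omega> T g z = w z"
proof -
  define p where "p = proj0 \<Omega> T g"
  have "\<exists>w. w \<in> P0_space \<Omega> T \<and> (\<forall>v\<in>P0_space \<Omega> T. L2_inner \<Omega> (\<lambda>z. g z - w z) v = 0)"
    using w orth by blast
  from someI_ex[OF this]
  have p: "p \<in> P0_space \<Omega> T" "\<And>v. v \<in> P0_space \<Omega> T \<Longrightarrow> L2_inner \<Omega> (\<lambda>z. g z - p z) v = 0"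
    unfolding p_def proj0_def L2_projection_def by simp_all
  then show "proj0 \<Omega> T g \<in> P0_space \<Omega> T" by (simp add: p_def)
  have L2: "p \<in> L2_space \<Omega>" "w \<in> L2_space \<Omega>" using p w by (simp_all add: P0_space_def)
  obtain c c' where c: "\<And>k z. k \<in> cells \<Longrightarrow> z \<in> ocell k \<Longrightarrow> p z = c k" "\<And>k z. k \<in> cells \<Longrightarrow> z \<in> ocell k \<Longrightarrow> w z = c' k"
    using P0_space_cells[OF p(1)] P0_space_cells[OF w] by metis
  define d where "d = (\<lambda>z. p z - w z)"
  have d: "d \<in> P0_space \<Omega> T"
    by (rule P0_spaceI[where c="\<lambda>k. c k - c' k"]) (simp add: d_def c)
  then have d2: "d \<in> L2_space \<Omega>" by (simp add: P0_space_def)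
  have "L2_inner \<Omega> d d = L2_inner \<Omega> (\<lambda>z. g z - w z) d - L2_inner \<Omega> (\<lambda>z. g z - p z) d"
    using L2_inner_diff_left[OF g L2(1) d2] L2_inner_diff_left[OF g L2(2) d2] L2_inner_diff_left[OF L2 d2]
    by (simp add: d_def)
  then have "L2_inner \<Omega> d d = 0" using orth[OF d] p(2)[OF d] by simp
  from L2_inner_self_eq_0[OF d2 this] show "AE z in lebesgue_on \<Omega>. proj0 \<Omega> T g z = w z"
    by (simp add: d_def p_def)
qed

text \<open>Each component of \<open>rt\<close> is affine in its own coordinate, so the field is the
  gradient of a sum of two one-variable quadratics, which is what an EQ polynomial is.\<close>

lemma potential_exists:
  assumes k: "k \<in> cells"
  shows "\<exists>p\<in>EQ_poly. (\<forall>z. grad p z = - rt l r b t k z) \<and> integral (cell k) p = c * measure lborel (cell k)"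
proof -
  define a a' where "a = x (fst k - 1)" "a' = y (snd k - 1)"
  define m m' where "m = (r k - l k) / (x (fst k) - x (fst k - 1))" "m' = (t k - b k) / (y (snd k) - y (snd k - 1))"
  \<comment> \<open>The expansion in monomials of C - l (s - a) - (m/2) (s - a)^2 - b (t - a') -
    (m'/2) (t - a')^2; thus C is the value at the lower left corner.\<close>
  define p where "p C z = (C - l k * (- a) - m / 2 * a\<^sup>2 - b k * (- a') - m' / 2 * a'\<^sup>2) + (m * a - l k) * fst z + (m' * a' - b k) * snd z
    + (- m / 2) * (fst z)\<^sup>2 + (- m' / 2) * (snd z)\<^sup>2" for C z
  have p: "\<forall>s t. p C (s, t) = (C - l k * (- a) - m / 2 * a\<^sup>2 - b k * (- a') - m' / 2 * a'\<^sup>2) + (m * a - l k) * s + (m' * a' - b k) * t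
    + (- m / 2) * s\<^sup>2 + (- m' / 2) * t\<^sup>2" for C
    by (simp add: p_def)
  then have EQ: "p C \<in> EQ_poly" for C unfolding EQ_poly_def by blast
  have rt_eq: "rt l r b t k z = (l k + m * (fst z - a), b k + m' * (snd z - a'))" for z
    by (simp add: rt_def ramp_def a_a'_def m_m'_def)
  have gr: "grad (p C) z = - rt l r b t k z" for C z
    using grad_eqI[OF EQ_poly_has_derivative[OF p[of C]], of z]
    by (simp add: rt_eq algebra_simps)
  \<comment> \<open>The shift that moves the mean of \<open>p 0\<close> over the cell to c.\<close>
  define C where "C = c - integral (cell k) (p 0) / measure lborel (cell k)"
  have "p C z = p 0 z + C" for z by (simp add: p_def)
  then have "integral (cell k) (p C) = integral (cell k) (\<lambda>z. p 0 z + C)" by presburger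
  also have "\<dots> = integral (cell k) (p 0) + C * measure lborel (cell k)"
    using C_k_Suc_continuous(1)[OF EQ_poly_C_k[OF EQ]]
    unfolding cell_def by (subst integral_add) (auto intro: integrable_continuous)
  also have "\<dots> = c * measure lborel (cell k)"
    using measure_cell[OF k] by (simp add: C_def field_simps)
  finally show ?thesis using EQ gr by blast
qed

text \<open>Induction on columns: the left edge of a cell is either on the frontier, where the edge
  integral vanishes, or shared with the cell to its left, which already carries 0. Column 0 contains
  no cells. As edges have positive length, a vanishing integral of a constant makes the constant
  0.\<close>

lemma conforming_constant_0:
  assumes v: "conforming v" and c: "\<And>k z. k \<in> cells \<Longrightarrow> z \<in> cell k \<Longrightarrow> v k z = c k" and k: "k \<in> cells"
  shows "c k = 0"
proof -
  have "\<forall>j. (i, j) \<in> cells \<longrightarrow> c (i, j) = 0" for i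
  proof (induction i)
    case 0
    then show ?case using cells_bounds(1) by force
  next
    case (Suc i)
    show ?case
    proof (intro allI impI)
      fix j assume cell: "(Suc i, j) \<in> cells"
      let ?e = "seg_left (Suc i, j)"
      have e: "?e \<in> cell_edges (cell (Suc i, j))" by (simp add: cell_edges_cell[OF cell])
      have const: "edge_integral ?e (v m) = dist (fst ?e) (snd ?e) * c m"
        if "m \<in> cells" "?e \<in> cell_edges (cell m)" for m
      proof -
        have "edge_integral ?e (v m) = edge_integral ?e (\<lambda>z. c m)"
          by (rule edge_integral_cong) (rule c[OF that(1) subsetD[OF segment_subset_cell[OF that]]])
        then show ?thesis by (simp add: edge_integral_const)
      qed
      have "dist (fst ?e) (snd ?e) \<noteq> 0" using cells_less[OF cell] by simp
      moreover have "edge_integral ?e (v (Suc i, j)) = 0"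
      proof (cases "on_frontier ?e")
        case True
        then show ?thesis by (rule conformingD(1)[OF v cell e])
      next
        case False
        note bd = cells_bounds[OF cell]
        have "?e = ((x i, y (j - 1)), (x i, y j))" "i \<le> n\<^sub>1" "1 \<le> j" "j \<le> n\<^sub>2" using bd by simp_all
        then have nb: "(i, j) \<in> cells" using vertical_neighbours[OF cell e False] by metis
        have e': "?e \<in> cell_edges (cell (i, j))" using cell_edges_cell[OF nb] by simp
        show ?thesis
          using conformingD(2)[OF v cell nb e e' False] const[OF nb e'] Suc.IH nb by simp
      qed
      ultimately show "c (Suc i, j) = 0" using const[OF cell e] by simp
    qed
  qed
  then show ?thesis using k by (metis prod.collapse)
qed

lemma broken_grad_eq:
  assumes "k \<in> cells" "z \<in> ocell k" "\<And>z. z \<in> ocell k \<Longrightarrow> v z = V z"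
  shows "broken_grad T v z = grad V z"
proof -
  have "z \<in> (\<Union>K\<in>T. interior K)" using assms(1,2) by (auto simp: T_eq interior_cell)
  moreover have "grad v z = grad V z"
    using assms(2,3) by (intro grad_cong_open[of "ocell k"]) (simp_all add: ocell_def open_box)
  ultimately show ?thesis by (simp add: broken_grad_def)
qed

lemma EQ_space_cells:
  assumes "v \<in> EQ_space \<Omega> T"
  obtains V where "\<And>k. k \<in> cells \<Longrightarrow> V k \<in> EQ_poly" "\<And>k z. k \<in> cells \<Longrightarrow> z \<in> ocell k \<Longrightarrow> v z = V k z" "conforming V"
proof -
  have "\<forall>k\<in>cells. \<exists>p. p \<in> EQ_poly \<and> (\<forall>z\<in>ocell k. v z = p z)"
    using assms by (auto simp: EQ_space_def T_eq interior_cell)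
  then obtain V where V: "\<forall>k\<in>cells. V k \<in> EQ_poly \<and> (\<forall>z\<in>ocell k. v z = V k z)"
    by (rule bchoice[THEN exE])
  have "conforming V"
    using assms V C_k_continuous[OF EQ_poly_C_k]
    by (subst conforming_iff_jumps[symmetric, of v]) (auto simp: EQ_space_def)
  with that V show thesis by blast
qed

lemma EQ_spaceI:
  assumes V: "\<And>k. k \<in> cells \<Longrightarrow> V k \<in> EQ_poly" "\<And>k z. k \<in> cells \<Longrightarrow> z \<in> ocell k \<Longrightarrow> v z = V k z" "conforming V"
  shows "v \<in> EQ_space \<Omega> T"
proof -
  have cont: "continuous_on UNIV (V k)" if "k \<in> cells" for k
    using C_k_continuous[OF EQ_poly_C_k[OF V(1)[OF that]]] .
  have "v \<in> L2_space \<Omega>"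
    by (rule L2_cells[where G=V]) (auto intro: continuous_on_subset[OF cont] V(2))
  moreover have "\<forall>e\<in>mesh_edges T. \<forall>g\<in>jumps \<Omega> T v e. edge_integral e g = 0"
    using conforming_iff_jumps[of v V] V(2,3) cont by blast
  ultimately show ?thesis using V(1,2) by (auto simp: EQ_space_def T_eq interior_cell)
qed

section \<open>Equivalence of the two schemes\<close>

lemma broken_grad_L2:
  assumes "\<And>k. k \<in> cells \<Longrightarrow> V k \<in> EQ_poly" "\<And>k z. k \<in> cells \<Longrightarrow> z \<in> ocell k \<Longrightarrow> v z = V k z"
  shows "broken_grad T v \<in> L2_space \<Omega>"
  by (rule L2_cells[where G="\<lambda>k. grad (V k)"])
    (auto intro: C_k_Suc_continuous(4)[OF EQ_poly_C_k] broken_grad_eq simp: assms)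

lemma L2_inner_broken_grad:
  assumes "\<And>k. k \<in> cells \<Longrightarrow> V k \<in> EQ_poly" "\<And>k z. k \<in> cells \<Longrightarrow> z \<in> ocell k \<Longrightarrow> v z = V k z"
    and "\<And>k. k \<in> cells \<Longrightarrow> W k \<in> EQ_poly" "\<And>k z. k \<in> cells \<Longrightarrow> z \<in> ocell k \<Longrightarrow> w z = W k z"
  shows "L2_inner \<Omega> (broken_grad T v) (broken_grad T w) =
    (\<Sum>k\<in>cells. integral (cell k) (\<lambda>z. grad (V k) z \<bullet> grad (W k) z))"
  by (rule L2_inner_cells)
    (auto intro: C_k_Suc_continuous(4)[OF EQ_poly_C_k] broken_grad_eq simp: assms)

text \<open>In Green's formula for \<tau> and W the volume terms are -(\<sigma>, \<tau>) + (div
  \<tau>, u), which the first RT equation cancels; what remains is the boundary sum that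
  \<open>conformingI\<close> asks for.\<close>

lemma RRT_solution_potential:
  assumes RRT: "RRT_solution \<Omega> T f \<sigma> u"
    and \<sigma>: "\<And>k z. k \<in> cells \<Longrightarrow> z \<in> ocell k \<Longrightarrow> \<sigma> z = rt l r b t k z"
    and u: "\<And>k z. k \<in> cells \<Longrightarrow> z \<in> ocell k \<Longrightarrow> u z = c k"
    and W: "\<And>k. k \<in> cells \<Longrightarrow> W k \<in> EQ_poly" "\<And>k z. k \<in> cells \<Longrightarrow> grad (W k) z = - rt l r b t k z"
      "\<And>k. k \<in> cells \<Longrightarrow> integral (cell k) (W k) = c k * measure lborel (cell k)"
  shows "conforming W"
proof (rule conformingI)
  show "continuous_on UNIV (W k)" if "k \<in> cells" for k
    by (rule C_k_continuous[OF EQ_poly_C_k[OF W(1)[OF that]]])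
next
  fix l' r' b' t'
  assume orth: "\<And>\<phi>. \<phi> \<in> test_functions \<Omega> \<Longrightarrow> bdry l' r' b' t' (\<lambda>k. \<phi>) = 0"
  define \<tau> where "\<tau> = cellwise (rt l' r' b' t')"
  have \<tau>: "\<tau> z = rt l' r' b' t' k z" if "k \<in> cells" "z \<in> ocell k" for k z
    unfolding \<tau>_def by (rule cellwise_eq[OF that])
  have RT: "\<tau> \<in> RT_space \<Omega> T" unfolding \<tau>_def by (rule cellwise_rt_RT_space[OF orth])
  then have "\<exists>d. has_weak_div \<Omega> \<tau> d" by (simp add: RT_space_def H_div_def)
  then have wd: "has_weak_div \<Omega> \<tau> (weak_div \<Omega> \<tau>)" unfolding weak_div_def by (rule someI_ex)
  have u0: "u \<in> P0_space \<Omega> T" using RRT by (simp add: RRT_solution_def)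
  have "L2_inner \<Omega> \<sigma> \<tau> = L2_inner \<Omega> (weak_div \<Omega> \<tau>) u"
    using RRT RT by (simp add: RRT_solution_def)
  also have "\<dots> = L2_inner \<Omega> (cellwise (\<lambda>k z. rt_div l' r' b' t' k)) u"
    by (rule weak_div_P0[OF \<tau> wd u0])
  also have "\<dots> = (\<Sum>k\<in>cells. integral (cell k) (\<lambda>z. rt_div l' r' b' t' k \<bullet> c k))"
    by (rule L2_inner_cells) (simp_all add: cellwise_eq u)
  \<comment> \<open>The divergence of \<tau> is constant on each cell, so u may be replaced by W,
    which has the same cell mean.\<close>
  also have "\<dots> = (\<Sum>k\<in>cells. integral (cell k) (\<lambda>z. rt_div l' r' b' t' k * W k z))"
    by (intro sum.cong) (simp_all add: W(3), simp add: cell_def)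
  finally have "L2_inner \<Omega> \<sigma> \<tau> = (\<Sum>k\<in>cells. integral (cell k) (\<lambda>z. rt_div l' r' b' t' k * W k z))" .
  moreover have "L2_inner \<Omega> \<sigma> \<tau> = (\<Sum>k\<in>cells. integral (cell k) (\<lambda>z. rt l r b t k z \<bullet> rt l' r' b' t' k z))"
    by (rule L2_inner_cells) (simp_all add: continuous_on_rt \<sigma> \<tau>)
  moreover have "(\<Sum>k\<in>cells. integral (cell k) (\<lambda>z. rt l' r' b' t' k z \<bullet> grad (W k) z)) =
      - (\<Sum>k\<in>cells. integral (cell k) (\<lambda>z. rt l r b t k z \<bullet> rt l' r' b' t' k z))"
    unfolding sum_negf[symmetric] by (intro sum.cong) (simp_all add: W(2) inner_commute)
  ultimately show "bdry l' r' b' t' W = 0"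
    using green[of W l' r' b' t'] EQ_poly_C_k[OF W(1)] by simp
qed

text \<open>Reduced by \<open>weak_div_P0\<close> to the elementwise divergence, the second RT
  equation says that this piecewise constant has the defining property of the projection of
  f.\<close>

lemma RRT_div:
  assumes RRT: "RRT_solution \<Omega> T f \<sigma> u" and f: "f \<in> L2_space \<Omega>"
    and \<sigma>: "\<And>k z. k \<in> cells \<Longrightarrow> z \<in> ocell k \<Longrightarrow> \<sigma> z = rt l r b t k z"
  shows "has_weak_div \<Omega> \<sigma> (weak_div \<Omega> \<sigma>)"
    and "proj0 \<Omega> T f \<in> P0_space \<Omega> T"
    and "AE z in lebesgue_on \<Omega>. proj0 \<Omega> T f z = cellwise (\<lambda>k z. rt_div l r b t k) z"
proof -
  let ?D = "cellwise (\<lambda>k z. rt_div l r b t k)"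
  have "\<exists>d. has_weak_div \<Omega> \<sigma> d" using RRT by (simp add: RRT_solution_def RT_space_def H_div_def)
  then show wd: "has_weak_div \<Omega> \<sigma> (weak_div \<Omega> \<sigma>)" unfolding weak_div_def by (rule someI_ex)
  have D: "?D \<in> P0_space \<Omega> T" by (rule P0_spaceI) (rule cellwise_eq)
  have "L2_inner \<Omega> (\<lambda>z. f z - ?D z) v = 0" if v: "v \<in> P0_space \<Omega> T" for v
  proof -
    have "L2_inner \<Omega> f v = L2_inner \<Omega> (weak_div \<Omega> \<sigma>) v"
      using RRT v by (simp add: RRT_solution_def)
    also have "\<dots> = L2_inner \<Omega> ?D v" by (rule weak_div_P0[OF \<sigma> wd v])
    finally show ?thesis
      using L2_inner_diff_left[OF f, of ?D v] D v by (simp add: P0_space_def)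
  qed
  from proj0_AE[OF f D this] show "proj0 \<Omega> T f \<in> P0_space \<Omega> T"
    "AE z in lebesgue_on \<Omega>. proj0 \<Omega> T f z = ?D z" by simp_all
qed

theorem PEQ_RRT_equivalence:
  assumes f: "f \<in> L2_space \<Omega>" and PEQ: "PEQ_solution \<Omega> T f v" and RRT: "RRT_solution \<Omega> T f \<sigma> u"
  shows "(AE z in lebesgue_on \<Omega>. \<sigma> z = - broken_grad T v z) \<and>
    (AE z in lebesgue_on \<Omega>. u z = proj0 \<Omega> T v z)"
proof -
  have vEQ: "v \<in> EQ_space \<Omega> T" using PEQ by (simp add: PEQ_solution_def)
  have "\<sigma> \<in> RT_space \<Omega> T" and uP0: "u \<in> P0_space \<Omega> T" using RRT by (simp_all add: RRT_solution_def)
  then obtain l r b t where \<sigma>: "\<And>k z. k \<in> cells \<Longrightarrow> z \<in> ocell k \<Longrightarrow> \<sigma> z = rt l r b t k z"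
    using RT_space_cells by metis
  obtain c where c: "\<And>k z. k \<in> cells \<Longrightarrow> z \<in> ocell k \<Longrightarrow> u z = c k"
    using P0_space_cells[OF uP0] by metis
  obtain V where V: "\<And>k. k \<in> cells \<Longrightarrow> V k \<in> EQ_poly" "\<And>k z. k \<in> cells \<Longrightarrow> z \<in> ocell k \<Longrightarrow> v z = V k z"
    "conforming V"
    using EQ_space_cells[OF vEQ] by metis
  have "\<forall>k\<in>cells. \<exists>p. p \<in> EQ_poly \<and> (\<forall>z. grad p z = - rt l r b t k z) \<and>
      integral (cell k) p = c k * measure lborel (cell k)"
    using potential_exists[unfolded Bex_def] by (intro ballI)
  then obtain W where "\<forall>k\<in>cells. W k \<in> EQ_poly \<and> (\<forall>z. grad (W k) z = - rt l r b t k z) \<and>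
      integral (cell k) (W k) = c k * measure lborel (cell k)"
    by (rule bchoice[THEN exE])
  then have W: "\<And>k. k \<in> cells \<Longrightarrow> W k \<in> EQ_poly" "\<And>k z. k \<in> cells \<Longrightarrow> grad (W k) z = - rt l r b t k z"
    "\<And>k. k \<in> cells \<Longrightarrow> integral (cell k) (W k) = c k * measure lborel (cell k)"
    by blast+
  have conf: "conforming W" by (rule RRT_solution_potential[OF RRT \<sigma> c W])
  define w where "w = cellwise W"
  have w: "w z = W k z" if "k \<in> cells" "z \<in> ocell k" for k z
    unfolding w_def by (rule cellwise_eq[OF that])
  have wEQ: "w \<in> EQ_space \<Omega> T" by (rule EQ_spaceI[OF W(1) w conf])
  note cont = C_k_continuous[OF EQ_poly_C_k]
  note cont_grad = C_k_Suc_continuous(4)[OF EQ_poly_C_k]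
  note \<sigma>_div = RRT_div[OF RRT f \<sigma>]

  \<comment> \<open>The broken gradient of w is minus \<sigma>, so Green's formula produces the
    elementwise divergence, which is the projection of f; the boundary sum vanishes because v' is
    conforming.\<close>
  have w_solves: "L2_inner \<Omega> (broken_grad T w) (broken_grad T v') = L2_inner \<Omega> (proj0 \<Omega> T f) v'"
    if v': "v' \<in> EQ_space \<Omega> T" for v'
  proof -
    obtain V' where V': "\<And>k. k \<in> cells \<Longrightarrow> V' k \<in> EQ_poly" "\<And>k z. k \<in> cells \<Longrightarrow> z \<in> ocell k \<Longrightarrow> v' z = V' k z"
      "conforming V'"
      using EQ_space_cells[OF v'] by metis
    let ?D = "cellwise (\<lambda>k z. rt_div l r b t k)"
    have D: "?D \<in> L2_space \<Omega>" by (intro cellwise_L2 continuous_on_const)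
    have "L2_inner \<Omega> (broken_grad T w) (broken_grad T v') =
        (\<Sum>k\<in>cells. integral (cell k) (\<lambda>z. grad (W k) z \<bullet> grad (V' k) z))"
      by (rule L2_inner_broken_grad[OF W(1) w V'(1,2)])
    also have "\<dots> = - (\<Sum>k\<in>cells. integral (cell k) (\<lambda>z. rt l r b t k z \<bullet> grad (V' k) z))"
      unfolding sum_negf[symmetric] by (intro sum.cong) (simp_all add: W(2))
    also have "\<dots> = (\<Sum>k\<in>cells. integral (cell k) (\<lambda>z. rt_div l r b t k * V' k z))"
      using green[of V' l r b t] EQ_poly_C_k[OF V'(1)]
        bdry_conforming[of \<sigma> l r b t, OF \<sigma> \<sigma>_div(1) V'(3) cont[OF V'(1)]] by simp
    also have "\<dots> = L2_inner \<Omega> ?D v'"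
      by (subst L2_inner_cells[where U="\<lambda>k z. rt_div l r b t k" and V=V'])
        (auto intro: continuous_on_subset[OF cont[OF V'(1)]] simp: cellwise_eq V'(2))
    also have "\<dots> = L2_inner \<Omega> (proj0 \<Omega> T f) v'"
      using \<sigma>_div(2,3) D v' by (intro L2_inner_cong_AE) (auto simp: P0_space_def EQ_space_def elim!: eventually_mono)
    finally show ?thesis .
  qed
  have v_solves: "L2_inner \<Omega> (broken_grad T v) (broken_grad T v') = L2_inner \<Omega> (proj0 \<Omega> T f) v'"
    if "v' \<in> EQ_space \<Omega> T" for v'
    using PEQ that by (simp add: PEQ_solution_def)

  have grad_eq: "grad (W k) z = grad (V k) z" if "k \<in> cells" "z \<in> cell k" for k z
  proof -
    define e where "e = (\<lambda>z. broken_grad T w z - broken_grad T v z)"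
    have L2w: "broken_grad T w \<in> L2_space \<Omega>" by (rule broken_grad_L2[OF W(1) w])
    have L2v: "broken_grad T v \<in> L2_space \<Omega>" by (rule broken_grad_L2[OF V(1,2)])
    note L2 = L2w L2v
    then have "e \<in> L2_space \<Omega>" unfolding e_def by (rule L2_space_diff)
    then have "L2_inner \<Omega> e e =
        (L2_inner \<Omega> (broken_grad T w) (broken_grad T w) - L2_inner \<Omega> (broken_grad T w) (broken_grad T v)) -
        (L2_inner \<Omega> (broken_grad T v) (broken_grad T w) - L2_inner \<Omega> (broken_grad T v) (broken_grad T v))"
      using L2_inner_diff_left[OF L2, of e] L2_inner_diff_left[OF L2, of "broken_grad T w"]
        L2_inner_diff_left[OF L2, of "broken_grad T v"] L2
      by (simp add: e_def[symmetric] L2_inner_commute)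
    \<comment> \<open>Both w and v solve the scheme and both are admissible test functions, so the
      four terms cancel.\<close>
    also have "\<dots> = 0"
      using w_solves v_solves wEQ vEQ by simp
    finally have "L2_inner \<Omega> e e = 0" .
    moreover have "L2_inner \<Omega> e e = (\<Sum>k\<in>cells. integral (cell k)
        (\<lambda>z. (grad (W k) z - grad (V k) z) \<bullet> (grad (W k) z - grad (V k) z)))"
      by (rule L2_inner_cells)
        (auto intro!: continuous_intros cont_grad simp: e_def W(1) V(1) broken_grad_eq[OF _ _ w] broken_grad_eq[OF _ _ V(2)])
    moreover have "0 \<le> integral (cell k) (\<lambda>z. (grad (W k) z - grad (V k) z) \<bullet> (grad (W k) z - grad (V k) z))"
      if "k \<in> cells" for k
      unfolding cell_def
      by (intro integral_nonneg integrable_continuous continuous_intros cont_grad W(1) V(1) that inner_ge_zero)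
    ultimately have "integral (cell k) (\<lambda>z. (grad (W k) z - grad (V k) z) \<bullet> (grad (W k) z - grad (V k) z)) = 0"
      using that(1) by (simp add: sum_nonneg_eq_0_iff[OF finite_cells])
    moreover have "continuous_on (cell k) (\<lambda>z. (grad (W k) z - grad (V k) z) \<bullet> (grad (W k) z - grad (V k) z))"
      by (intro continuous_intros cont_grad W(1) V(1) that(1))
    moreover have "box (x (fst k - 1), y (snd k - 1)) (x (fst k), y (snd k)) \<noteq> {}"
      using cells_less[OF that(1)] by (simp add: box_ne_empty Basis_prod_def)
    \<comment> \<open>A continuous nonnegative function with integral 0 over a nondegenerate box
      vanishes on all of it, edges included.\<close>
    ultimately have "(grad (W k) z - grad (V k) z) \<bullet> (grad (W k) z - grad (V k) z) = 0"
      using that(2) unfolding cell_def by (subst (asm) integral_cbox_eq_0_iff) auto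
    then show ?thesis by simp
  qed

  have VW: "V k z = W k z" if k: "k \<in> cells" "z \<in> cell k" for k z
  proof -
    \<comment> \<open>The upper right corner is a point of the cell at which the constant value of
      the difference can be read off.\<close>
    define c' where "c' k = W k (x (fst k), y (snd k)) - V k (x (fst k), y (snd k))" for k
    have const: "W k z - V k z = c' k" if k: "k \<in> cells" "z \<in> cell k" for k z
    proof -
      have "((\<lambda>z. W k z - V k z) has_derivative (\<lambda>h. 0)) (at z within cell k)" if "z \<in> cell k" for z
        using has_derivative_diff[OF C_kD[OF EQ_poly_C_k[OF W(1)[OF k(1)]]] C_kD[OF EQ_poly_C_k[OF V(1)[OF k(1)]]], of z]
          grad_eq[OF k(1) that]
        by (simp add: has_derivative_at_withinI)
      moreover have "convex (cell k)" by (simp add: cell_def convex_box)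
      ultimately obtain C where C: "\<And>z. z \<in> cell k \<Longrightarrow> W k z - V k z = C"
        using has_derivative_zero_constant[of "cell k" "\<lambda>z. W k z - V k z"] by blast
      have "(x (fst k), y (snd k)) \<in> cell k" using cells_less[OF k(1)] by (simp add: mem_cell)
      then show ?thesis using C k(2) by (simp add: c'_def)
    qed
    have "conforming (\<lambda>k z. W k z - V k z)"
      by (rule conforming_diff[OF conf V(3)]) (auto intro: cont W(1) V(1))
    from conforming_constant_0[OF this const k(1)] const[OF k] show ?thesis by simp
  qed

  have "AE z in lebesgue_on \<Omega>. \<sigma> z = - broken_grad T v z"
    using AE_cells
  proof eventually_elim
    case (elim z)
    then obtain k where k: "k \<in> cells" "z \<in> ocell k" by blast
    have "broken_grad T v z = grad (V k) z"
      by (rule broken_grad_eq[OF k V(2)[OF k(1)]])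
    also have "\<dots> = grad (W k) z"
      using grad_eq[OF k(1) subsetD[OF ocell_subset_cell k(2)]] by simp
    finally have "broken_grad T v z = grad (W k) z" .
    then show ?case using \<sigma>[OF k] W(2)[OF k(1)] by simp
  qed
  moreover have "AE z in lebesgue_on \<Omega>. u z = proj0 \<Omega> T v z"
  proof -
    have v2: "v \<in> L2_space \<Omega>" using vEQ by (simp add: EQ_space_def)
    \<comment> \<open>v agrees with W in the open cells, and W is normalised to have the cell mean c
      of u; so u has the defining property of the projection of v.\<close>
    have "L2_inner \<Omega> (\<lambda>z. v z - u z) q = 0" if q: "q \<in> P0_space \<Omega> T" for q
    proof -
      obtain d where d: "\<And>k z. k \<in> cells \<Longrightarrow> z \<in> ocell k \<Longrightarrow> q z = d k"
        using P0_space_cells[OF q] by metis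
      have cW: "continuous_on S (W k)" if "k \<in> cells" for k S
        by (rule continuous_on_subset[OF cont[OF W(1)[OF that]]]) simp
      have "L2_inner \<Omega> (\<lambda>z. v z - u z) q = (\<Sum>k\<in>cells. integral (cell k) (\<lambda>z. (W k z - c k) \<bullet> d k))"
        using ocell_subset_cell
        by (intro L2_inner_cells) (auto intro!: continuous_intros cW simp: c d V(2) VW subset_eq)
      also have "\<dots> = (\<Sum>k\<in>cells. 0)"
      proof (rule sum.cong)
        fix k assume k: "k \<in> cells"
        have "integral (cell k) (\<lambda>z. W k z - c k) = integral (cell k) (W k) - integral (cell k) (\<lambda>z. c k)"
          unfolding cell_def by (intro integral_diff integrable_continuous cW[OF k] continuous_on_const)
        also have "\<dots> = 0" by (simp add: W(3)[OF k]) (simp add: cell_def)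
        finally show "integral (cell k) (\<lambda>z. (W k z - c k) \<bullet> d k) = 0" by simp
      qed simp
      finally show ?thesis by simp
    qed
    then have "AE z in lebesgue_on \<Omega>. proj0 \<Omega> T v z = u z" by (rule proj0_AE(2)[OF v2 uP0])
    then show ?thesis by eventually_elim simp
  qed
  ultimately show ?thesis ..
qed

end

theorem theorem10:
  fixes \<Omega> :: "(real \<times> real) set"
    and n\<^sub>1 n\<^sub>2 :: nat and x y :: "nat \<Rightarrow> real"
    and T :: "(real \<times> real) set set"
    and f u_PEQ u_RRT :: "real \<times> real \<Rightarrow> real"
    and \<sigma>_RRT :: "real \<times> real \<Rightarrow> real \<times> real"
  assumes domain: "open \<Omega>" "connected \<Omega>" "bounded \<Omega>" "\<Omega> \<noteq> {}"
    and grid: "strict_mono_on {0..n\<^sub>1} x" "strict_mono_on {0..n\<^sub>2} y"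
    and mesh: "T = grid_mesh \<Omega> n\<^sub>1 x n\<^sub>2 y"
    and division: "closure \<Omega> = \<Union>T" "\<forall>K\<in>T. interior K \<subseteq> \<Omega>"
    and f: "f \<in> L2_space \<Omega>"
    and PEQ: "PEQ_solution \<Omega> T f u_PEQ"
    and RRT: "RRT_solution \<Omega> T f \<sigma>_RRT u_RRT"
  shows "(AE z in lebesgue_on \<Omega>. \<sigma>_RRT z = - broken_grad T u_PEQ z) \<and>
         (AE z in lebesgue_on \<Omega>. u_RRT z = proj0 \<Omega> T u_PEQ z)"
proof -
  interpret rect_mesh \<Omega> n\<^sub>1 n\<^sub>2 x y T
    using domain(1,3) grid mesh division by (rule rect_mesh.intro)
  show ?thesis by (rule PEQ_RRT_equivalence[OF f PEQ RRT])
qed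

end
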